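(* Let $1\le p<\infty$, let $\mathcal{T}:\mathscr{D}(\mathcal{T})\subset X_p\to X_p$ be a densely defined unbounded operator with $s(\mathcal{T})<0$ and $(0-\mathcal{T})^{-1}(X_p^+)\subset X_p^+$, and let $\mathcal{K}_s,\mathcal{K}_f$ be nonnegative bounded operators in $X_p$; set $\mathcal{K}=\mathcal{K}_s+\mathcal{K}_f$ and $\mathcal{K}(\gamma)=\mathcal{K}_s+\frac1\gamma\mathcal{K}_f$ for $\gamma>0$. Assume that $(0-\mathcal{T})^{-1}\mathcal{K}$ is power-compact, $(0-\mathcal{T})^{-1}\mathcal{K}_f$ is irreducible, $\lim_{\gamma\to0}r_\sigma[(0-\mathcal{T})^{-1}\mathcal{K}(\gamma)]>1$ and $r_\sigma[(0-\mathcal{T})^{-1}\mathcal{K}_s]<1$. Let $N\in\mathbb{N}$ be such that $[(0-\mathcal{T})^{-1}\mathcal{K}(\gamma)]^N$ is compact for every $\gamma>0$. Let $(\varphi_k)_k\subset\mathscr{D}(\mathcal{T})\cap X_p^+$ be a sequence such that $\gamma_k:=\tau_+(\varphi_k)\to k_{\mathrm{eff}}$ (with $\gamma_k>0$), normalized by $$\big\|[(0-\mathcal{T})^{-1}\mathcal{K}(\gamma_k)]^N\varphi_k\big\|=1\qquad(k\in\mathbb{N}).$$ Assume that $1$ is a simple eigenvalue of $(0-\mathcal{T})^{-1}\mathcal{K}(k_{\mathrm{eff}})$. Moreover, in the case $p=1$, assume that the dual operator $[(0-\mathcal{T})^{-1}\mathcal{K}(k_{\mathrm{eff}})]^\star$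 admits an eigenfunction associated to its spectral radius which is bounded away from zero. Then $$\lim_{k\to\infty}\|\varphi_k-\phi_{\mathrm{eff}}\|=0,$$ where $\phi_{\mathrm{eff}}\in\mathscr{D}(\mathcal{T})\cap X_p^+$ is the unique positive eigenfunction of $(0-\mathcal{T})^{-1}\mathcal{K}(k_{\mathrm{eff}})$ associated to the eigenvalue $1$ and with unit norm.
   Context: $(\mathbf{\Omega},\nu)$ is a measure space, $X_p=L^p(\mathbf{\Omega},d\nu)$ with norm $\|\cdot\|$, whose dual is identified with $X_q=L^q(\mathbf{\Omega},d\nu)$, $1/p+1/q=1$, with pairing $\langle\cdot,\cdot\rangle$. $X_p^+=\{f\in X_p: f>0\ \nu\text{-a.e.}\}$. $s(\mathcal{T})$ is the spectral bound of $\mathcal{T}$; $r_\sigma[B]$ is the spectral radius of a bounded operator $B$. A bounded operator is nonnegative if it maps nonnegative functions to nonnegative functions. $B$ is irreducible if for all nonnegative $\varphi\in X_p\setminus\{0\}$, $\psi\in X_q\setminus\{0\}$ there is $n\in\mathbb{N}$ with $\langle B^n\varphi,\psi\rangle>0$; $B$ is power-compact if some power $B^n$ is compact. For $\varphi\in\mathscr{D}(\mathcal{T})\cap X_p^+$, $\tau_+(\varphi)=\sup\{\gamma>0:(\mathcal{T}+\mathcal{K}(\gamma))\varphi\text{ is nonnegative}\}$, with $\sup\varnothing=0$. Under the stated assumptions it is known that there is a unique $k_{\mathrm{eff}}>0$ for which $(\mathcal{T}+\mathcal{K}(k_{\mathrm{eff}}))\phi=0$ has a nonnegative solution $\phi\in\mathscr{D}(\mathcal{T})\setminus\{0\}$;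 it is characterized by $r_\sigma[(0-\mathcal{T})^{-1}\mathcal{K}(k_{\mathrm{eff}})]=1$. *)

theory Defs
  imports "HOL-Analysis.Analysis"
begin

text \<open>
  Elements of \<open>L\<^sup>p(M)\<close> are represented by complex-valued measurable functions, and equality in
  \<open>L\<^sup>p(M)\<close> is equality \<open>M\<close>-almost everywhere.  Accordingly, an operator is a map on
  representatives whose algebraic identities hold almost everywhere and which is compatible with
  almost-everywhere equality.  Scalars are complex because spectra are taken in the complex plane.
  Exponents range over \<open>ennreal\<close>, so that \<open>p = \<infinity>\<close> is included and \<open>inverse \<infinity> = 0\<close>.
\<close>

type_synonym 'a cfun = "'a \<Rightarrow> complex"
type_synonym 'a operator = "'a cfun \<Rightarrow> 'a cfun"

section \<open>Lebesgue spaces\<close>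

definition ae_eq :: "'a measure \<Rightarrow> 'a cfun \<Rightarrow> 'a cfun \<Rightarrow> bool" where
  "ae_eq M f g \<longleftrightarrow> (AE x in M. f x = g x)"

definition Lp :: "'a measure \<Rightarrow> ennreal \<Rightarrow> 'a cfun set" where
  "Lp M p = {f \<in> borel_measurable M.
     if p = \<infinity> then \<exists>C. AE x in M. norm (f x) \<le> C
     else integrable M (\<lambda>x. norm (f x) powr enn2real p)}"

definition Lp_norm :: "'a measure \<Rightarrow> ennreal \<Rightarrow> 'a cfun \<Rightarrow> real" where
  "Lp_norm M p f =
     (if p = \<infinity> then Inf {C. 0 \<le> C \<and> (AE x in M. norm (f x) \<le> C)}
      else (\<integral>x. norm (f x) powr enn2real p \<partial>M) powr (1 / enn2real p))"

definition pairing :: "'a measure \<Rightarrow> 'a cfun \<Rightarrow> 'a cfun \<Rightarrow> complex" where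
  "pairing M f g = (\<integral>x. f x * g x \<partial>M)"

definition nonneg_fun :: "'a measure \<Rightarrow> 'a cfun \<Rightarrow> bool" where
  "nonneg_fun M f \<longleftrightarrow> (AE x in M. f x \<in> \<real> \<and> 0 \<le> Re (f x))"

definition Lp_pos :: "'a measure \<Rightarrow> ennreal \<Rightarrow> 'a cfun set" where
  "Lp_pos M p = {f \<in> Lp M p. AE x in M. f x \<in> \<real> \<and> 0 < Re (f x)}"

section \<open>Operators\<close>

text \<open>The last clause of \<open>lin_op\<close> makes \<open>T\<close> and its domain \<open>D\<close> well defined on almost-everywhere classes.\<close>

definition lin_op :: "'a measure \<Rightarrow> ennreal \<Rightarrow> 'a cfun set \<Rightarrow> 'a operator \<Rightarrow> bool" where
  "lin_op M p D T \<longleftrightarrow>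
     D \<subseteq> Lp M p \<and> (\<lambda>x. 0) \<in> D \<and>
     (\<forall>f\<in>D. T f \<in> Lp M p) \<and>
     (\<forall>f\<in>D. \<forall>g\<in>D. (\<lambda>x. f x + g x) \<in> D \<and>
        ae_eq M (T (\<lambda>x. f x + g x)) (\<lambda>x. T f x + T g x)) \<and>
     (\<forall>c. \<forall>f\<in>D. (\<lambda>x. c * f x) \<in> D \<and> ae_eq M (T (\<lambda>x. c * f x)) (\<lambda>x. c * T f x)) \<and>
     (\<forall>f\<in>D. \<forall>g\<in>Lp M p. ae_eq M f g \<longrightarrow> g \<in> D \<and> ae_eq M (T f) (T g))"

definition densely_defined :: "'a measure \<Rightarrow> ennreal \<Rightarrow> 'a cfun set \<Rightarrow> bool" where
  "densely_defined M p D \<longleftrightarrow>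
     (\<forall>f\<in>Lp M p. \<forall>\<epsilon>>0. \<exists>g\<in>D. Lp_norm M p (\<lambda>x. f x - g x) < \<epsilon>)"

definition bounded_op :: "'a measure \<Rightarrow> ennreal \<Rightarrow> 'a operator \<Rightarrow> bool" where
  "bounded_op M p B \<longleftrightarrow>
     lin_op M p (Lp M p) B \<and> (\<exists>C. \<forall>f\<in>Lp M p. Lp_norm M p (B f) \<le> C * Lp_norm M p f)"

definition nonneg_op :: "'a measure \<Rightarrow> ennreal \<Rightarrow> 'a operator \<Rightarrow> bool" where
  "nonneg_op M p B \<longleftrightarrow> (\<forall>f\<in>Lp M p. nonneg_fun M f \<longrightarrow> nonneg_fun M (B f))"

definition op_add :: "'a operator \<Rightarrow> 'a operator \<Rightarrow> 'a operator" where
  "op_add A B = (\<lambda>f x. A f x + B f x)"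

definition op_scale :: "complex \<Rightarrow> 'a operator \<Rightarrow> 'a operator" where
  "op_scale c A = (\<lambda>f x. c * A f x)"

definition compact_op :: "'a measure \<Rightarrow> ennreal \<Rightarrow> 'a operator \<Rightarrow> bool" where
  "compact_op M p A \<longleftrightarrow> bounded_op M p A \<and>
     (\<forall>u::nat \<Rightarrow> 'a cfun. (\<forall>n. u n \<in> Lp M p) \<and> (\<exists>C. \<forall>n. Lp_norm M p (u n) \<le> C) \<longrightarrow>
        (\<exists>r::nat \<Rightarrow> nat. \<exists>g\<in>Lp M p. strict_mono r \<and>
           (\<lambda>n. Lp_norm M p (\<lambda>x. A (u (r n)) x - g x)) \<longlonglongrightarrow> 0))"

definition power_compact :: "'a measure \<Rightarrow> ennreal \<Rightarrow> 'a operator \<Rightarrow> bool" where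
  "power_compact M p B \<longleftrightarrow> (\<exists>n\<ge>1. compact_op M p (B ^^ n))"

text \<open>\<open>q\<close> is the exponent conjugate to \<open>p\<close>.\<close>

definition irreducible_op :: "'a measure \<Rightarrow> ennreal \<Rightarrow> ennreal \<Rightarrow> 'a operator \<Rightarrow> bool" where
  "irreducible_op M p q B \<longleftrightarrow>
     (\<forall>\<phi>\<in>Lp M p. \<forall>\<psi>\<in>Lp M q.
        nonneg_fun M \<phi> \<and> \<not> ae_eq M \<phi> (\<lambda>x. 0) \<and> nonneg_fun M \<psi> \<and> \<not> ae_eq M \<psi> (\<lambda>x. 0) \<longrightarrow>
        (\<exists>n::nat. pairing M ((B ^^ n) \<phi>) \<psi> \<in> \<real> \<and> 0 < Re (pairing M ((B ^^ n) \<phi>) \<psi>)))"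

definition dual_op :: "'a measure \<Rightarrow> ennreal \<Rightarrow> ennreal \<Rightarrow> 'a operator \<Rightarrow> 'a operator \<Rightarrow> bool" where
  "dual_op M p q B B' \<longleftrightarrow> bounded_op M q B' \<and>
     (\<forall>f\<in>Lp M p. \<forall>g\<in>Lp M q. pairing M (B f) g = pairing M f (B' g))"

section \<open>Spectral notions\<close>

text \<open>\<open>is_resolvent M p D T \<mu> R\<close>: \<open>R\<close> represents \<open>(\<mu> - T)\<^sup>-\<^sup>1\<close>, an everywhere defined bounded operator.\<close>

definition is_resolvent ::
    "'a measure \<Rightarrow> ennreal \<Rightarrow> 'a cfun set \<Rightarrow> 'a operator \<Rightarrow> complex \<Rightarrow> 'a operator \<Rightarrow> bool" where
  "is_resolvent M p D T \<mu> R \<longleftrightarrow> bounded_op M p R \<and>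
     (\<forall>f\<in>Lp M p. R f \<in> D \<and> ae_eq M (\<lambda>x. \<mu> * R f x - T (R f) x) f) \<and>
     (\<forall>f\<in>D. ae_eq M (R (\<lambda>x. \<mu> * f x - T f x)) f)"

definition spectrum ::
    "'a measure \<Rightarrow> ennreal \<Rightarrow> 'a cfun set \<Rightarrow> 'a operator \<Rightarrow> complex set" where
  "spectrum M p D T = {\<mu>. \<nexists>R. is_resolvent M p D T \<mu> R}"

definition spectral_bound ::
    "'a measure \<Rightarrow> ennreal \<Rightarrow> 'a cfun set \<Rightarrow> 'a operator \<Rightarrow> ereal" where
  "spectral_bound M p D T = (SUP \<mu>\<in>spectrum M p D T. ereal (Re \<mu>))"

definition spectral_radius :: "'a measure \<Rightarrow> ennreal \<Rightarrow> 'a operator \<Rightarrow> ennreal" where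
  "spectral_radius M p B = (SUP \<mu>\<in>spectrum M p (Lp M p) B. ennreal (cmod \<mu>))"

definition eigenfunction ::
    "'a measure \<Rightarrow> ennreal \<Rightarrow> 'a operator \<Rightarrow> complex \<Rightarrow> 'a cfun \<Rightarrow> bool" where
  "eigenfunction M p B \<mu> f \<longleftrightarrow>
     f \<in> Lp M p \<and> \<not> ae_eq M f (\<lambda>x. 0) \<and> ae_eq M (B f) (\<lambda>x. \<mu> * f x)"

text \<open>Simplicity is algebraic: the generalized eigenspace is one-dimensional.\<close>

definition simple_eigenvalue :: "'a measure \<Rightarrow> ennreal \<Rightarrow> 'a operator \<Rightarrow> complex \<Rightarrow> bool" where
  "simple_eigenvalue M p B \<mu> \<longleftrightarrow>
     (\<exists>f. eigenfunction M p B \<mu> f \<and>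
        (\<forall>h\<in>Lp M p. (\<exists>n. ae_eq M (((\<lambda>u x. \<mu> * u x - B u x) ^^ n) h) (\<lambda>x. 0)) \<longrightarrow>
           (\<exists>c. ae_eq M h (\<lambda>x. c * f x))))"

section \<open>The effective multiplication factor\<close>

definition K_op :: "'a operator \<Rightarrow> 'a operator \<Rightarrow> real \<Rightarrow> 'a operator" where
  "K_op Ks Kf \<gamma> = op_add Ks (op_scale (complex_of_real (1 / \<gamma>)) Kf)"

text \<open>The supremum is taken in \<open>ennreal\<close>: it is \<open>0\<close> for the empty set and may be infinite.\<close>

definition tau_plus ::
    "'a measure \<Rightarrow> 'a operator \<Rightarrow> 'a operator \<Rightarrow> 'a operator \<Rightarrow> 'a cfun \<Rightarrow> ennreal" where
  "tau_plus M T Ks Kf \<phi> =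
     (SUP \<gamma>\<in>{\<gamma>::real. 0 < \<gamma> \<and> nonneg_fun M (op_add T (K_op Ks Kf \<gamma>) \<phi>)}. ennreal \<gamma>)"

definition is_keff ::
    "'a measure \<Rightarrow> 'a cfun set \<Rightarrow> 'a operator \<Rightarrow> 'a operator \<Rightarrow> 'a operator \<Rightarrow> real \<Rightarrow> bool" where
  "is_keff M D T Ks Kf k \<longleftrightarrow> 0 < k \<and>
     (\<exists>\<phi>\<in>D. nonneg_fun M \<phi> \<and> \<not> ae_eq M \<phi> (\<lambda>x. 0) \<and>
        ae_eq M (op_add T (K_op Ks Kf k) \<phi>) (\<lambda>x. 0))"

end

theory Submission
  imports Defs
begin

text \<open>Put \<open>B\<^sub>\<gamma> = (0 - T)\<^sup>-\<^sup>1 K(\<gamma>)\<close> and \<open>B = B\<^sub>\<gamma>\<close> for \<open>\<gamma> = k\<^sub>e\<^sub>f\<^sub>f\<close>.  The choice \<open>\<gamma>\<^sub>k = \<tau>\<^sub>+(\<phi>\<^sub>k)\<close> implies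
\<open>(T + K(\<gamma>\<^sub>k)) \<phi>\<^sub>k \<ge> 0\<close> (\<open>nonneg_at_tau_plus\<close>), and since \<open>(0 - T)\<^sup>-\<^sup>1\<close> is positive this says
\<open>\<phi>\<^sub>k \<le> B\<^sub>\<gamma>\<^sub>k \<phi>\<^sub>k\<close>.  Call \<open>u\<close> superinvariant under an operator \<open>A\<close> if \<open>u \<le> A u\<close>, subinvariant if
\<open>A u \<le> u\<close>; then \<open>\<phi>\<^sub>k\<close> is superinvariant under \<open>B\<^sub>\<gamma>\<^sub>k\<close>.  The definition of \<open>k\<^sub>e\<^sub>f\<^sub>f\<close> provides a
nonnegative \<open>e \<noteq> 0\<close> with \<open>B e = e\<close>, and irreducibility makes it strictly positive
(\<open>subinvariant_pos\<close>).

The limit is found by comparing functions in the order of the Lebesgue space.  Compactness of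
\<open>B\<^sup>N\<close> shows that a sequence of nonnegative, nonzero superinvariant functions cannot have supports
shrinking to a null set (\<open>vanishing_superinvariant\<close>).  Consequently a
superinvariant function lies below a multiple of any strictly positive subinvariant one
(\<open>superinvariant_le_subinvariant\<close>), and a nonnegative superinvariant function is a multiple of \<open>e\<close>
(\<open>superinvariant_eq_multiple\<close>).  The latter yields both the uniqueness of the positive
eigenfunction and the identification of every limit point of \<open>B\<^sub>\<gamma>\<^sub>k\<^sup>N \<phi>\<^sub>k\<close> as the normalised \<open>e\<close>.

The bound \<open>0 \<le> \<phi>\<^sub>k \<le> B\<^sub>\<gamma>\<^sub>k\<^sup>N \<phi>\<^sub>k\<close> transfers convergence to \<open>\<phi>\<^sub>k\<close> only from above.  The deficit of
\<open>\<phi>\<^sub>k\<close> below the limit lies in an order interval and is sent to zero by \<open>B\<^sup>N\<close>; because \<open>B\<^sup>N\<close>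
annihilates no nonzero positive function (\<open>power_kernel_trivial\<close>), the deficit itself tends to zero
(\<open>order_interval_limit\<close>).  The limiting argument is \<open>perturbed_superinvariant_tendsto\<close>; it is
carried out for real functions, to which the complex operators of the statement are restricted by
\<open>realify\<close>.\<close>

section \<open>Real Lebesgue spaces\<close>

text \<open>If one of the two points is zero, convexity comes down to \<open>s powr P \<le> s\<close> for \<open>0 \<le> s \<le> 1\<close>.\<close>

lemma powr_mean_le:
  fixes a b t P :: real
  assumes "1 \<le> P" "0 \<le> a" "0 \<le> b" "0 \<le> t" "t \<le> 1"
  shows "((1 - t) * a + t * b) powr P \<le> (1 - t) * a powr P + t * b powr P"
proof -
  have scaled: "(s * c) powr P \<le> s * c powr P" if "0 \<le> s" "s \<le> 1" "0 \<le> c" for s c :: real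
  proof -
    have "s powr P \<le> s"
      using powr_mono'[of 1 P s] that assms(1) by (cases "s = 0") auto
    then show ?thesis
      using that by (simp add: powr_mult mult_right_mono)
  qed
  show ?thesis
  proof (cases "a = 0 \<or> b = 0")
    case True
    then show ?thesis
      using scaled[of t b] scaled[of "1 - t" a] assms by auto
  next
    case False
    then show ?thesis
      using convex_onD[OF powr_convex[OF assms(1)], of t a b] assms by auto
  qed
qed

text \<open>The order arguments take place in the real space \<open>L\<^sup>P\<close> for a finite exponent \<open>P\<close>; equalities and
inequalities between its elements hold almost everywhere.\<close>

locale real_Lp =
  fixes M :: "'a measure" and P :: real
  assumes P_ge_1: "1 \<le> P"
begin

definition L :: "('a \<Rightarrow> real) set" where
  "L = {u \<in> borel_measurable M. integrable M (\<lambda>x. \<bar>u x\<bar> powr P)}"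

definition nrm :: "('a \<Rightarrow> real) \<Rightarrow> real" where
  "nrm u = (\<integral>x. \<bar>u x\<bar> powr P \<partial>M) powr (1 / P)"

lemma P_pos: "0 < P" and P_nz: "P \<noteq> 0"
  using P_ge_1 by auto

lemma L_measurable[measurable_dest, dest]: "u \<in> L \<Longrightarrow> u \<in> borel_measurable M"
  by (simp add: L_def)

lemma L_integrable: "u \<in> L \<Longrightarrow> integrable M (\<lambda>x. \<bar>u x\<bar> powr P)"
  by (simp add: L_def)

lemma nrm_nonneg[simp]: "0 \<le> nrm u"
  by (simp add: nrm_def)

lemma nrm_powr: "nrm u powr P = (\<integral>x. \<bar>u x\<bar> powr P \<partial>M)"
  using P_pos by (simp add: nrm_def powr_powr)

lemma L_dominated:
  assumes "u \<in> L" and [measurable]: "v \<in> borel_measurable M" and "AE x in M. \<bar>v x\<bar> \<le> \<bar>u x\<bar>"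
  shows "v \<in> L" "nrm v \<le> nrm u"
proof -
  have le: "AE x in M. \<bar>v x\<bar> powr P \<le> \<bar>u x\<bar> powr P"
    using assms(3) by eventually_elim (use P_pos in \<open>auto intro: powr_mono2\<close>)
  have "integrable M (\<lambda>x. \<bar>v x\<bar> powr P)"
    by (rule Bochner_Integration.integrable_bound[OF L_integrable[OF assms(1)]]) (use le in auto)
  then show "v \<in> L"
    by (simp add: L_def)
  show "nrm v \<le> nrm u"
    unfolding nrm_def
    using le P_pos
    by (intro powr_mono2 integral_mono_AE L_integrable assms \<open>v \<in> L\<close>) auto
qed

lemma nrm_cong_AE:
  assumes "u \<in> borel_measurable M" "v \<in> borel_measurable M" "AE x in M. u x = v x"
  shows "nrm u = nrm v"
  unfolding nrm_def using assms
  by (intro arg_cong[where f="\<lambda>i. i powr _"] integral_cong_AE) auto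

lemma L_scale: "u \<in> L \<Longrightarrow> (\<lambda>x. c * u x) \<in> L"
  by (auto simp: L_def abs_mult powr_mult)

lemma nrm_scale: "nrm (\<lambda>x. c * u x) = \<bar>c\<bar> * nrm u"
  using P_nz by (simp add: nrm_def abs_mult powr_mult powr_powr)

lemma L_zero: "(\<lambda>x. 0) \<in> L"
  using P_nz by (simp add: L_def)

lemma nrm_zero[simp]: "nrm (\<lambda>x. 0) = 0"
  by (simp add: nrm_def)

lemma nrm_eq_0:
  assumes "u \<in> L" "nrm u = 0"
  shows "AE x in M. u x = 0"
proof -
  have "(\<integral>x. \<bar>u x\<bar> powr P \<partial>M) = 0"
    using nrm_powr[of u] assms(2) P_nz by simp
  then have "AE x in M. \<bar>u x\<bar> powr P = 0"
    using integral_nonneg_eq_0_iff_AE[OF L_integrable[OF assms(1)]] by auto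
  then show ?thesis
    by eventually_elim auto
qed

text \<open>Minkowski's inequality is the convexity of the unit ball: after normalising both
  summands, the sum is a convex combination, and \<^term>\<open>\<lambda>t::real. t powr P\<close> is convex.\<close>

lemma Minkowski:
  assumes u: "u \<in> L" and v: "v \<in> L"
  shows "(\<lambda>x. u x + v x) \<in> L" "nrm (\<lambda>x. u x + v x) \<le> nrm u + nrm v"
proof -
  have [measurable]: "u \<in> borel_measurable M" "v \<in> borel_measurable M"
    using u v by auto
  have convexity: "\<bar>u x + v x\<bar> powr P \<le> (a + b) powr P *
      (a / (a + b) * (\<bar>u x\<bar> powr P / a powr P) + b / (a + b) * (\<bar>v x\<bar> powr P / b powr P))"
    if "0 < a" "0 < b" for a b x
  proof -
    have t: "1 - b / (a + b) = a / (a + b)"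
      using that by (simp add: field_simps)
    have "\<bar>u x + v x\<bar> powr P \<le> (\<bar>u x\<bar> + \<bar>v x\<bar>) powr P"
      using P_pos by (intro powr_mono2) auto
    also have "\<bar>u x\<bar> + \<bar>v x\<bar> = (a + b) * (a / (a + b) * (\<bar>u x\<bar> / a) + b / (a + b) * (\<bar>v x\<bar> / b))"
      using that by (simp add: distrib_left)
    also have "\<dots> powr P = (a + b) powr P * (a / (a + b) * (\<bar>u x\<bar> / a) + b / (a + b) * (\<bar>v x\<bar> / b)) powr P"
      using that by (simp add: powr_mult)
    also have "\<dots> \<le> (a + b) powr P *
        (a / (a + b) * (\<bar>u x\<bar> / a) powr P + b / (a + b) * (\<bar>v x\<bar> / b) powr P)"
      using powr_mean_le[of P "\<bar>u x\<bar> / a" "\<bar>v x\<bar> / b" "b / (a + b)"] that P_ge_1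
      unfolding t by (intro mult_left_mono) auto
    finally show ?thesis
      using that by (simp add: powr_divide)
  qed
  have int: "integrable M (\<lambda>x. \<bar>u x + v x\<bar> powr P)"
    by (rule Bochner_Integration.integrable_bound[where f="\<lambda>x. (1 + 1) powr P *
      (1 / (1 + 1) * (\<bar>u x\<bar> powr P / 1 powr P) + 1 / (1 + 1) * (\<bar>v x\<bar> powr P / 1 powr P))"])
      (use L_integrable[OF u] L_integrable[OF v] convexity[of 1 1] in auto)
  then show uv: "(\<lambda>x. u x + v x) \<in> L"
    by (simp add: L_def)
  define a b where "a = nrm u" and "b = nrm v"
  show "nrm (\<lambda>x. u x + v x) \<le> nrm u + nrm v"
  proof (cases "a = 0 \<or> b = 0")
    case True
    then show ?thesis
    proof
      assume "a = 0"
      then have "AE x in M. u x = 0" using u nrm_eq_0 a_def by auto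
      then have "AE x in M. u x + v x = v x" by eventually_elim auto
      then have "nrm (\<lambda>x. u x + v x) = nrm v" by (intro nrm_cong_AE) auto
      then show ?thesis by simp
    next
      assume "b = 0"
      then have "AE x in M. v x = 0" using v nrm_eq_0 b_def by auto
      then have "AE x in M. u x + v x = u x" by eventually_elim auto
      then have "nrm (\<lambda>x. u x + v x) = nrm u" by (intro nrm_cong_AE) auto
      then show ?thesis by simp
    qed
  next
    case False
    then have pos: "0 < a" "0 < b"
      using nrm_nonneg[of u] nrm_nonneg[of v] by (auto simp: a_def b_def less_le)
    have "(\<integral>x. \<bar>u x + v x\<bar> powr P \<partial>M) \<le> (\<integral>x. (a + b) powr P *
      (a / (a + b) * (\<bar>u x\<bar> powr P / a powr P) + b / (a + b) * (\<bar>v x\<bar> powr P / b powr P)) \<partial>M)"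
      using L_integrable[OF u] L_integrable[OF v] convexity[OF pos] int
      by (intro integral_mono) auto
    also have "\<dots> = (a + b) powr P * (a / (a + b) * (a powr P / a powr P) + b / (a + b) * (b powr P / b powr P))"
      using L_integrable[OF u] L_integrable[OF v] by (simp add: nrm_powr a_def b_def)
    also have "\<dots> = (a + b) powr P"
      using pos by (simp add: add_divide_distrib[symmetric])
    finally have "nrm (\<lambda>x. u x + v x) \<le> ((a + b) powr P) powr (1 / P)"
      unfolding nrm_def using P_pos by (intro powr_mono2) auto
    then show ?thesis
      using pos P_pos by (simp add: powr_powr a_def b_def)
  qed
qed

lemma L_diff: "u \<in> L \<Longrightarrow> v \<in> L \<Longrightarrow> (\<lambda>x. u x - v x) \<in> L"
  using Minkowski(1)[of u "\<lambda>x. (-1) * v x"] L_scale[of v "-1"] by simp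

lemma nrm_minus: "nrm (\<lambda>x. u x - v x) = nrm (\<lambda>x. v x - u x)"
  by (simp add: nrm_def abs_minus_commute)

lemma nrm_triangle: 
  assumes "u \<in> L" "v \<in> L" "w \<in> L"
  shows "nrm (\<lambda>x. u x - w x) \<le> nrm (\<lambda>x. u x - v x) + nrm (\<lambda>x. v x - w x)"
  using Minkowski(2)[of "\<lambda>x. u x - v x" "\<lambda>x. v x - w x"] assms by (simp add: L_diff)

lemma nrm_le_diff: 
  assumes "u \<in> L" "v \<in> L"
  shows "nrm u \<le> nrm (\<lambda>x. u x - v x) + nrm v"
  using Minkowski(2)[of "\<lambda>x. u x - v x" v] assms by (simp add: L_diff)

lemma L_abs: "u \<in> L \<Longrightarrow> (\<lambda>x. \<bar>u x\<bar>) \<in> L"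
  by (rule L_dominated(1)[of u]) auto

lemma nrm_abs: "nrm (\<lambda>x. \<bar>u x\<bar>) = nrm u"
  by (simp add: nrm_def)

lemma nrm_le_add:
  assumes "u \<in> L" "v \<in> L" "w \<in> L" "AE x in M. \<bar>u x\<bar> \<le> \<bar>v x\<bar> + \<bar>w x\<bar>"
  shows "nrm u \<le> nrm v + nrm w"
proof -
  have "nrm u \<le> nrm (\<lambda>x. \<bar>v x\<bar> + \<bar>w x\<bar>)"
    using assms by (intro L_dominated(2) Minkowski L_abs) auto
  also have "\<dots> \<le> nrm v + nrm w"
    using Minkowski(2)[OF L_abs[OF assms(2)] L_abs[OF assms(3)]] by (simp add: nrm_abs)
  finally show ?thesis .
qed

lemma nrm_squeeze: "(\<And>n. nrm (u n) \<le> b n) \<Longrightarrow> b \<longlonglongrightarrow> 0 \<Longrightarrow> (\<lambda>n. nrm (u n)) \<longlonglongrightarrow> 0"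
  by (rule tendsto_sandwich[OF _ _ tendsto_const]) auto

lemma L_pos_part: "u \<in> L \<Longrightarrow> (\<lambda>x. max 0 (u x)) \<in> L"
  by (rule L_dominated(1)[of u]) auto

lemma nrm_limit_eq_0:
  assumes "u \<in> L" "\<And>n. v n \<in> L" "\<And>n. AE x in M. \<bar>u x\<bar> \<le> \<bar>v n x\<bar>" "(\<lambda>n. nrm (v n)) \<longlonglongrightarrow> 0"
  shows "AE x in M. u x = 0"
proof (rule nrm_eq_0[OF assms(1)])
  have "nrm u \<le> nrm (v n)" for n
    by (rule L_dominated(2)[OF assms(2) _ assms(3)]) (use assms(1) in auto)
  then have "nrm u \<le> 0"
    by (intro LIMSEQ_le_const[OF assms(4)]) auto
  then show "nrm u = 0"
    using nrm_nonneg[of u] by linarith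
qed

lemma sum_in_L: "finite I \<Longrightarrow> (\<And>i. i \<in> I \<Longrightarrow> u i \<in> L) \<Longrightarrow> (\<lambda>x. \<Sum>i\<in>I. u i x) \<in> L"
  by (induction I rule: finite_induct) (auto simp: L_zero intro: Minkowski)

lemma nrm_sum_le:
  "finite I \<Longrightarrow> (\<And>i. i \<in> I \<Longrightarrow> u i \<in> L) \<Longrightarrow> nrm (\<lambda>x. \<Sum>i\<in>I. u i x) \<le> (\<Sum>i\<in>I. nrm (u i))"
proof (induction I rule: finite_induct)
  case (insert i I)
  then have "nrm (\<lambda>x. u i x + (\<Sum>j\<in>I. u j x)) \<le> nrm (u i) + nrm (\<lambda>x. \<Sum>j\<in>I. u j x)"
    by (intro Minkowski sum_in_L) auto
  with insert show ?case by simp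
qed simp

lemma nrm_dominated_convergence:
  assumes w: "w \<in> L" and u: "\<And>n. u n \<in> borel_measurable M"
    and dom: "\<And>n. AE x in M. \<bar>u n x\<bar> \<le> \<bar>w x\<bar>" and lim: "AE x in M. (\<lambda>n. u n x) \<longlonglongrightarrow> 0"
  shows "(\<lambda>n. nrm (u n)) \<longlonglongrightarrow> 0"
proof -
  have "(\<lambda>n. \<integral>x. \<bar>u n x\<bar> powr P \<partial>M) \<longlonglongrightarrow> (\<integral>x. 0 \<partial>M)"
  proof (rule integral_dominated_convergence[OF _ _ L_integrable[OF w]])
    show "AE x in M. (\<lambda>n. \<bar>u n x\<bar> powr P) \<longlonglongrightarrow> 0"
      using lim
    proof eventually_elim
      case (elim x)
      have "(\<lambda>n. \<bar>u n x\<bar> powr P) \<longlonglongrightarrow> 0 powr P"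
        using P_pos tendsto_rabs[OF elim] by (intro tendsto_powr') auto
      then show ?case by simp
    qed
    show "AE x in M. norm (\<bar>u n x\<bar> powr P) \<le> \<bar>w x\<bar> powr P" for n
      using dom[of n] by eventually_elim (use P_pos in \<open>auto intro: powr_mono2\<close>)
  qed (use u in auto)
  then have "(\<lambda>n. (\<integral>x. \<bar>u n x\<bar> powr P \<partial>M) powr (1 / P)) \<longlonglongrightarrow> 0 powr (1 / P)"
    using P_pos by (intro tendsto_powr') auto
  then show ?thesis
    by (simp add: nrm_def)
qed

section \<open>Positive operators\<close>

text \<open>The identities hold almost everywhere.  Positivity makes such an operator compatible with equality
almost everywhere (\<open>posop_cong\<close> below), since a function that vanishes almost everywhere is both
nonnegative and nonpositive.\<close>

definition posop :: "(('a \<Rightarrow> real) \<Rightarrow> ('a \<Rightarrow> real)) \<Rightarrow> bool" where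
  "posop A \<longleftrightarrow>
     (\<forall>u\<in>L. A u \<in> L) \<and>
     (\<forall>u\<in>L. \<forall>v\<in>L. AE x in M. A (\<lambda>x. u x + v x) x = A u x + A v x) \<and>
     (\<forall>c. \<forall>u\<in>L. AE x in M. A (\<lambda>x. c * u x) x = c * A u x) \<and>
     (\<forall>u\<in>L. (AE x in M. 0 \<le> u x) \<longrightarrow> (AE x in M. 0 \<le> A u x)) \<and>
     (\<exists>C\<ge>0. \<forall>u\<in>L. nrm (A u) \<le> C * nrm u)"

lemma posop_in: "posop A \<Longrightarrow> u \<in> L \<Longrightarrow> A u \<in> L"
  and posop_add: "posop A \<Longrightarrow> u \<in> L \<Longrightarrow> v \<in> L \<Longrightarrow> AE x in M. A (\<lambda>x. u x + v x) x = A u x + A v x"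
  and posop_scale: "posop A \<Longrightarrow> u \<in> L \<Longrightarrow> AE x in M. A (\<lambda>x. c * u x) x = c * A u x"
  and posop_nonneg: "posop A \<Longrightarrow> u \<in> L \<Longrightarrow> AE x in M. 0 \<le> u x \<Longrightarrow> AE x in M. 0 \<le> A u x"
  and posop_bound: "posop A \<Longrightarrow> \<exists>C\<ge>0. \<forall>u\<in>L. nrm (A u) \<le> C * nrm u"
  unfolding posop_def by blast+

lemma posop_diff:
  assumes A: "posop A" and u: "u \<in> L" and v: "v \<in> L"
  shows "AE x in M. A (\<lambda>x. u x - v x) x = A u x - A v x"
proof -
  have diff: "(\<lambda>x. u x - v x) = (\<lambda>x. u x + (- 1) * v x)"
    by simp
  have "AE x in M. A (\<lambda>x. u x - v x) x = A u x + A (\<lambda>x. (- 1) * v x) x"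
    unfolding diff by (rule posop_add[OF A u L_scale[OF v]])
  moreover have "AE x in M. A (\<lambda>x. (- 1) * v x) x = (- 1) * A v x"
    by (rule posop_scale[OF A v])
  ultimately show ?thesis
    by eventually_elim linarith
qed

lemma posop_mono:
  assumes A: "posop A" and u: "u \<in> L" and v: "v \<in> L" and "AE x in M. u x \<le> v x"
  shows "AE x in M. A u x \<le> A v x"
proof -
  have "AE x in M. 0 \<le> A (\<lambda>x. v x - u x) x"
    by (rule posop_nonneg[OF A L_diff[OF v u]]) (use assms(4) in auto)
  with posop_diff[OF A v u] show ?thesis
    by eventually_elim auto
qed

lemma posop_cong:
  assumes A: "posop A" and u: "u \<in> L" and v: "v \<in> L" and eq: "AE x in M. u x = v x"
  shows "AE x in M. A u x = A v x"
proof -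
  have "AE x in M. A u x \<le> A v x" "AE x in M. A v x \<le> A u x"
    by (rule posop_mono[OF A]; use u v eq in auto)+
  then show ?thesis
    by eventually_elim auto
qed

lemma posop_sum:
  assumes A: "posop A" and "finite I" and "\<And>i. i \<in> I \<Longrightarrow> u i \<in> L"
  shows "AE x in M. A (\<lambda>x. \<Sum>i\<in>I. u i x) x = (\<Sum>i\<in>I. A (u i) x)"
  using assms(2,3)
proof (induction I rule: finite_induct)
  case empty
  show ?case
    using posop_scale[OF A L_zero, of 0] by simp
next
  case (insert i I)
  have "AE x in M. A (\<lambda>x. u i x + (\<Sum>j\<in>I. u j x)) x = A (u i) x + A (\<lambda>x. \<Sum>j\<in>I. u j x) x"
    by (rule posop_add[OF A]) (use insert in \<open>auto intro: sum_in_L\<close>)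
  moreover have "AE x in M. A (\<lambda>x. \<Sum>j\<in>I. u j x) x = (\<Sum>j\<in>I. A (u j) x)"
    using insert by auto
  ultimately show ?case
    by eventually_elim (use insert in simp)
qed

lemma posop_limit:
  assumes A: "posop A" and "\<And>n. u n \<in> L" "(\<lambda>n. nrm (u n)) \<longlonglongrightarrow> 0"
  shows "(\<lambda>n. nrm (A (u n))) \<longlonglongrightarrow> 0"
proof -
  obtain C where C: "\<And>u. u \<in> L \<Longrightarrow> nrm (A u) \<le> C * nrm u"
    using posop_bound[OF A] by blast
  have "(\<lambda>n. C * nrm (u n)) \<longlonglongrightarrow> C * 0"
    by (intro tendsto_intros assms)
  then show ?thesis
    by (intro nrm_squeeze[of "\<lambda>n. A (u n)" "\<lambda>n. C * nrm (u n)"]) (auto simp: C assms)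
qed

lemma nrm_posop_diff:
  assumes "posop A" "u \<in> L" "v \<in> L"
  shows "nrm (\<lambda>x. A u x - A v x) = nrm (A (\<lambda>x. u x - v x))"
proof (rule nrm_cong_AE)
  show "AE x in M. A u x - A v x = A (\<lambda>x. u x - v x) x"
    using posop_diff[OF assms] by eventually_elim simp
qed (use assms in \<open>auto intro!: L_measurable L_diff posop_in[OF assms(1)]\<close>)

lemma posop_id: "posop (\<lambda>u. u)"
  unfolding posop_def by (auto intro!: exI[of _ 1])

lemma posop_comp:
  assumes A: "posop A" and B: "posop B"
  shows "posop (\<lambda>u. A (B u))"
  unfolding posop_def
proof (intro conjI ballI allI impI)
  fix u v assume uv: "u \<in> L" "v \<in> L"
  have "AE x in M. A (B (\<lambda>x. u x + v x)) x = A (\<lambda>x. B u x + B v x) x"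
    by (intro posop_cong[OF A] posop_in[OF B] posop_add[OF B] Minkowski uv)
  with posop_add[OF A posop_in[OF B uv(1)] posop_in[OF B uv(2)]]
  show "AE x in M. A (B (\<lambda>x. u x + v x)) x = A (B u) x + A (B v) x"
    by eventually_elim simp
next
  fix c u assume u: "u \<in> L"
  have "AE x in M. A (B (\<lambda>x. c * u x)) x = A (\<lambda>x. c * B u x) x"
    by (intro posop_cong[OF A] posop_in[OF B] posop_scale[OF B] L_scale u)
  with posop_scale[OF A posop_in[OF B u], of c]
  show "AE x in M. A (B (\<lambda>x. c * u x)) x = c * A (B u) x"
    by eventually_elim simp
next
  fix u assume u: "u \<in> L" "AE x in M. 0 \<le> u x"
  show "AE x in M. 0 \<le> A (B u) x"
    by (rule posop_nonneg[OF A posop_in[OF B u(1)] posop_nonneg[OF B u]])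
next
  obtain C1 where C1: "C1 \<ge> 0" "\<And>u. u \<in> L \<Longrightarrow> nrm (A u) \<le> C1 * nrm u"
    using posop_bound[OF A] by blast
  obtain C2 where C2: "C2 \<ge> 0" "\<And>u. u \<in> L \<Longrightarrow> nrm (B u) \<le> C2 * nrm u"
    using posop_bound[OF B] by blast
  have "nrm (A (B u)) \<le> C1 * C2 * nrm u" if "u \<in> L" for u
  proof -
    have "nrm (A (B u)) \<le> C1 * nrm (B u)"
      using that by (intro C1 posop_in[OF B])
    also have "\<dots> \<le> C1 * (C2 * nrm u)"
      using that by (intro mult_left_mono C1 C2)
    finally show ?thesis by simp
  qed
  then show "\<exists>C\<ge>0. \<forall>u\<in>L. nrm (A (B u)) \<le> C * nrm u"
    using C1 C2 by (intro exI[of _ "C1 * C2"]) auto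
qed (simp add: posop_in[OF A] posop_in[OF B])

lemma posop_power: "posop A \<Longrightarrow> posop (A ^^ n)"
  using posop_id posop_comp[of A "A ^^ n" for n] by (induction n) (auto simp: comp_def id_def)

lemma posop_add_scaled:
  assumes A: "posop A" and B: "posop B" and t: "0 \<le> t"
  shows "posop (\<lambda>u x. A u x + t * B u x)"
  unfolding posop_def
proof (intro conjI ballI allI impI)
  fix u assume u: "u \<in> L"
  show "(\<lambda>x. A u x + t * B u x) \<in> L"
    by (intro Minkowski L_scale posop_in[OF A] posop_in[OF B] u)
next
  fix u v assume uv: "u \<in> L" "v \<in> L"
  show "AE x in M. A (\<lambda>x. u x + v x) x + t * B (\<lambda>x. u x + v x) x = A u x + t * B u x + (A v x + t * B v x)"
    using posop_add[OF A uv] posop_add[OF B uv] by eventually_elim (simp add: algebra_simps)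
next
  fix c u assume u: "u \<in> L"
  show "AE x in M. A (\<lambda>x. c * u x) x + t * B (\<lambda>x. c * u x) x = c * (A u x + t * B u x)"
    using posop_scale[OF A u, of c] posop_scale[OF B u, of c] by eventually_elim (simp add: algebra_simps)
next
  fix u assume u: "u \<in> L" "AE x in M. 0 \<le> u x"
  show "AE x in M. 0 \<le> A u x + t * B u x"
    using posop_nonneg[OF A u] posop_nonneg[OF B u] by eventually_elim (simp add: t)
next
  obtain C1 where C1: "C1 \<ge> 0" "\<And>u. u \<in> L \<Longrightarrow> nrm (A u) \<le> C1 * nrm u"
    using posop_bound[OF A] by blast
  obtain C2 where C2: "C2 \<ge> 0" "\<And>u. u \<in> L \<Longrightarrow> nrm (B u) \<le> C2 * nrm u"
    using posop_bound[OF B] by blast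
  have "nrm (\<lambda>x. A u x + t * B u x) \<le> (C1 + t * C2) * nrm u" if u: "u \<in> L" for u
  proof -
    have "nrm (\<lambda>x. A u x + t * B u x) \<le> nrm (A u) + nrm (\<lambda>x. t * B u x)"
      by (intro Minkowski L_scale posop_in[OF A] posop_in[OF B] u)
    also have "\<dots> \<le> C1 * nrm u + t * (C2 * nrm u)"
      unfolding nrm_scale using t u C1 C2 by (intro add_mono) (auto intro: mult_left_mono)
    finally show ?thesis by (simp add: algebra_simps)
  qed
  then show "\<exists>C\<ge>0. \<forall>u\<in>L. nrm (\<lambda>x. A u x + t * B u x) \<le> C * nrm u"
    using C1 C2 t by (intro exI[of _ "C1 + t * C2"]) auto
qed

lemma superinvariant_power:
  assumes A: "posop A" and u: "u \<in> L" and le: "AE x in M. u x \<le> A u x"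
  shows "AE x in M. u x \<le> (A ^^ n) u x"
proof (induction n)
  case (Suc n)
  have "AE x in M. A u x \<le> A ((A ^^ n) u) x"
    by (intro posop_mono[OF A] u posop_in[OF posop_power[OF A]] Suc)
  with le show ?case by eventually_elim simp
qed simp

end


section \<open>Sub- and superinvariant functions\<close>

text \<open>The setting of the Perron--Frobenius argument: a positive operator with a compact power and a
strictly positive fixed function \<open>e\<close>.  Irreducibility is expressed in terms of the order, as strict
positivity of nonzero nonnegative subinvariant functions.  The clause that \<open>e\<close> does not vanish
almost everywhere excludes the null measure.\<close>

locale irreducible_fixed_point = real_Lp +
  fixes B :: "('a \<Rightarrow> real) \<Rightarrow> ('a \<Rightarrow> real)" and e :: "'a \<Rightarrow> real" and N :: nat
  assumes B: "posop B"
    and e: "e \<in> L" "AE x in M. 0 < e x" "AE x in M. B e x = e x" "\<not> (AE x in M. e x = 0)"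
    and irreducible: "\<And>u. \<lbrakk>u \<in> L; AE x in M. 0 \<le> u x; AE x in M. B u x \<le> u x;
          \<not> (AE x in M. u x = 0)\<rbrakk> \<Longrightarrow> AE x in M. 0 < u x"
    and compact: "\<And>(u::nat \<Rightarrow> 'a \<Rightarrow> real) C. \<lbrakk>\<And>n. u n \<in> L; \<And>n. nrm (u n) \<le> C\<rbrakk> \<Longrightarrow>
          \<exists>r g. strict_mono (r :: nat \<Rightarrow> nat) \<and> g \<in> L \<and> (\<lambda>n. nrm (\<lambda>x. (B ^^ N) (u (r n)) x - g x)) \<longlonglongrightarrow> 0"
begin

lemmas B_in = posop_in[OF B] and BN = posop_power[OF B, of N] and BN_in = posop_in[OF posop_power[OF B, of N]]

text \<open>Were all \<open>v m\<close> nonzero, they could be rescaled so that \<open>B\<^sup>N y\<close> has norm one,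
where \<open>y\<close> is the rescaled function.  Superinvariance gives \<open>0 \<le> y \<le> B\<^sup>N y\<close>, and along a
subsequence \<open>B\<^sup>N y\<close> converges to some \<open>g\<close>.  So \<open>y\<close> is dominated, up to a norm-small error, by the
restriction of \<open>g\<close> to the support of \<open>v m\<close>.  These supports shrink to a null set, hence \<open>y\<close>, and
with it \<open>B\<^sup>N y\<close>, tends to zero in norm.\<close>

lemma vanishing_superinvariant:
  fixes v :: "nat \<Rightarrow> 'a \<Rightarrow> real"
  assumes v: "\<And>m. v m \<in> L" "\<And>m. AE x in M. 0 \<le> v m x" "\<And>m. AE x in M. v m x \<le> B (v m) x"
    and vanish: "AE x in M. eventually (\<lambda>m. v m x = 0) sequentially"
  shows "\<exists>m. AE x in M. v m x = 0"
proof (rule ccontr)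
  assume "\<nexists>m. AE x in M. v m x = 0"
  then have nz: "nrm (v m) \<noteq> 0" for m
    using nrm_eq_0[OF v(1)[of m]] by auto
  define a where "a m = nrm ((B ^^ N) (v m))" for m
  have abs_le: "AE x in M. \<bar>v m x\<bar> \<le> \<bar>(B ^^ N) (v m) x\<bar>" for m
    using superinvariant_power[OF B v(1)[of m] v(3)[of m], of N] v(2)[of m] by eventually_elim auto
  have a: "0 < a m" for m
    using L_dominated(2)[OF BN_in[OF v(1)] L_measurable[OF v(1)] abs_le] nz[of m] nrm_nonneg[of "v m"]
    unfolding a_def by (metis less_le order_trans antisym)
  define y where "y m = (\<lambda>x. 1 / a m * v m x)" for m
  have y: "y m \<in> L" for m
    unfolding y_def by (intro L_scale v)
  have By: "AE x in M. (B ^^ N) (y m) x = 1 / a m * (B ^^ N) (v m) x" for m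
    unfolding y_def by (rule posop_scale[OF BN v(1)])
  have nBy: "nrm ((B ^^ N) (y m)) = 1" for m
  proof -
    have "nrm ((B ^^ N) (y m)) = nrm (\<lambda>x. 1 / a m * (B ^^ N) (v m) x)"
      by (intro nrm_cong_AE[OF _ _ By] L_measurable BN_in y L_scale v)
    also have "\<dots> = \<bar>1 / a m\<bar> * a m"
      unfolding nrm_scale a_def ..
    finally show ?thesis
      using a[of m] by simp
  qed
  have y_le: "AE x in M. \<bar>y m x\<bar> \<le> \<bar>(B ^^ N) (y m) x\<bar>" for m
    using abs_le[of m] By[of m]
    by eventually_elim (use a[of m] in \<open>simp add: y_def divide_right_mono\<close>)
  have "nrm (y m) \<le> 1" for m
    using L_dominated(2)[OF BN_in[OF y] L_measurable[OF y] y_le] nBy by simp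
  then obtain r g where r: "strict_mono r" and g: "g \<in> L"
    and lim: "(\<lambda>n. nrm (\<lambda>x. (B ^^ N) (y (r n)) x - g x)) \<longlonglongrightarrow> 0"
    using compact[of y 1] y by blast
  define h where "h n = (\<lambda>x. if v (r n) x = 0 then 0 else g x)" for n
  have h_meas: "h n \<in> borel_measurable M" for n
  proof -
    have [measurable]: "v (r n) \<in> borel_measurable M" "g \<in> borel_measurable M"
      using v g by auto
    show ?thesis unfolding h_def by measurable
  qed
  have h: "h n \<in> L" for n
    by (rule L_dominated(1)[OF g h_meas]) (auto simp: h_def)
  have "(\<lambda>n. nrm (h n)) \<longlonglongrightarrow> 0"
  proof (rule nrm_dominated_convergence[OF g h_meas])
    show "AE x in M. (\<lambda>n. h n x) \<longlonglongrightarrow> 0"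
      using vanish
    proof eventually_elim
      case (elim x)
      then have "eventually (\<lambda>n. v (r n) x = 0) sequentially"
        by (rule eventually_compose_filterlim[OF _ filterlim_subseq[OF r]])
      then have "eventually (\<lambda>n. h n x = 0) sequentially"
        by eventually_elim (simp add: h_def)
      then show ?case by (rule tendsto_eventually)
    qed
  qed (auto simp: h_def)
  with lim have lim': "(\<lambda>n. nrm (\<lambda>x. (B ^^ N) (y (r n)) x - g x) + nrm (h n)) \<longlonglongrightarrow> 0"
    using tendsto_add by fastforce
  have "nrm (y (r n)) \<le> nrm (\<lambda>x. (B ^^ N) (y (r n)) x - g x) + nrm (h n)" for n
  proof (rule nrm_le_add[OF y L_diff[OF BN_in[OF y] g] h])
    show "AE x in M. \<bar>y (r n) x\<bar> \<le> \<bar>(B ^^ N) (y (r n)) x - g x\<bar> + \<bar>h n x\<bar>"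
      using y_le[of "r n"] by eventually_elim (auto simp: h_def y_def)
  qed
  then have "(\<lambda>n. nrm (y (r n))) \<longlonglongrightarrow> 0"
    by (rule nrm_squeeze[OF _ lim'])
  then have "(\<lambda>n. nrm ((B ^^ N) (y (r n)))) \<longlonglongrightarrow> 0"
    by (rule posop_limit[OF BN y])
  then show False
    by (simp add: nBy LIMSEQ_const_iff)
qed

text \<open>The excess \<open>(g - m u)\<^sup>+\<close> is again superinvariant, because positivity of \<open>B\<close> gives
\<open>B (w\<^sup>+) \<ge> (B w)\<^sup>+\<close>, and its support shrinks to a null set as \<open>m\<close> grows, because \<open>u\<close> is strictly
positive.  So the excess is zero for some \<open>m\<close>.\<close>

lemma superinvariant_le_subinvariant:
  assumes g: "g \<in> L" "AE x in M. g x \<le> B g x"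
    and u: "u \<in> L" "AE x in M. 0 < u x" "AE x in M. B u x \<le> u x"
  shows "\<exists>m::nat. AE x in M. g x \<le> real m * u x"
proof -
  define v where "v m = (\<lambda>x. max 0 (g x - real m * u x))" for m :: nat
  have v: "v m \<in> L" for m
    unfolding v_def by (intro L_pos_part L_diff L_scale g u)
  have "\<exists>m. AE x in M. v m x = 0"
  proof (rule vanishing_superinvariant[OF v])
    show "AE x in M. v m x \<le> B (v m) x" for m
    proof -
      have w: "(\<lambda>x. g x - real m * u x) \<in> L"
        by (intro L_diff L_scale g u)
      have "AE x in M. 0 \<le> B (v m) x"
        by (rule posop_nonneg[OF B v]) (simp add: v_def)
      moreover have "AE x in M. B (\<lambda>x. g x - real m * u x) x \<le> B (v m) x"
        by (rule posop_mono[OF B w v]) (simp add: v_def)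
      moreover have "AE x in M. B (\<lambda>x. g x - real m * u x) x = B g x - B (\<lambda>x. real m * u x) x"
        by (rule posop_diff[OF B g(1) L_scale[OF u(1)]])
      moreover have "AE x in M. B (\<lambda>x. real m * u x) x = real m * B u x"
        by (rule posop_scale[OF B u(1)])
      ultimately show ?thesis
        using g(2) u(3)
      proof eventually_elim
        case (elim x)
        have "real m * B u x \<le> real m * u x"
          using elim by (intro mult_left_mono) auto
        then show ?case using elim by (simp add: v_def)
      qed
    qed
    show "AE x in M. eventually (\<lambda>m. v m x = 0) sequentially"
      using u(2)
    proof eventually_elim
      case (elim x)
      obtain k :: nat where k: "g x < real k * u x"
        using reals_Archimedean3[OF elim] by blast
      have "v m x = 0" if "k \<le> m" for m
      proof -
        have "real k * u x \<le> real m * u x"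
          using that elim by (intro mult_right_mono) auto
        with k show ?thesis by (simp add: v_def)
      qed
      then show ?case by (auto simp: eventually_sequentially)
    qed
  qed (simp add: v_def)
  then obtain m where "AE x in M. v m x = 0" by blast
  then have "AE x in M. g x \<le> real m * u x"
    by eventually_elim (simp add: v_def max_def split: if_splits)
  then show ?thesis by blast
qed

lemma e_invariant: "AE x in M. e x \<le> B e x" "AE x in M. B e x \<le> e x"
  using e(3) by auto

text \<open>Take the least \<open>c\<close> with \<open>g \<le> c e\<close>.  The gap \<open>h = c e - g\<close> is nonnegative and subinvariant.  If it
were nonzero, irreducibility would make it strictly positive, so \<open>e \<le> m h\<close> for some \<open>m\<close> by the
previous comparison, and \<open>c\<close> could be decreased by \<open>1 / m\<close>.  In particular every nonnegative
superinvariant function is invariant, and the nonnegative fixed functions form a single ray.\<close>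

theorem superinvariant_eq_multiple:
  assumes g: "g \<in> L" "AE x in M. 0 \<le> g x" "AE x in M. g x \<le> B g x"
  shows "\<exists>c. AE x in M. g x = c * e x"
proof -
  \<comment> \<open>The infimum is attained since the inequality passes to the limit on a common null set.\<close>
  define K where "K = {c::real. AE x in M. g x \<le> c * e x}"
  obtain m :: nat where "real m \<in> K"
    using superinvariant_le_subinvariant[OF g(1,3) e(1,2) e_invariant(2)] by (auto simp: K_def)
  then have ne: "K \<noteq> {}" by auto
  have lower: "0 \<le> c" if "c \<in> K" for c
  proof (rule ccontr)
    assume "\<not> 0 \<le> c"
    have "AE x in M. g x \<le> c * e x"
      using that by (simp add: K_def)
    with e(2) g(2) have "AE x in M. False"
    proof eventually_elim
      case (elim x)
      have "c * e x < 0" using elim \<open>\<not> 0 \<le> c\<close> by (intro mult_neg_pos) auto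
      then show ?case using elim by simp
    qed
    then have "AE x in M. e x = 0" by eventually_elim simp
    then show False using e(4) by simp
  qed
  have bdd: "bdd_below K"
    by (rule bdd_belowI[of _ 0]) (rule lower)
  define c where "c = Inf K"
  have cK: "AE x in M. g x \<le> c * e x"
  proof -
    have "\<exists>a\<in>K. a < c + 1 / real (Suc n)" for n
      unfolding c_def using cInf_lessD[OF ne, of "Inf K + 1 / real (Suc n)"] by auto
    then obtain a where a: "\<And>n. a n \<in> K" "\<And>n. a n < c + 1 / real (Suc n)"
      by metis
    have "AE x in M. \<forall>n. g x \<le> a n * e x"
      using a(1) by (simp add: K_def AE_all_countable)
    with e(2) show ?thesis
    proof eventually_elim
      case (elim x)
      have "g x \<le> (c + 1 / real (Suc n)) * e x" for n
        using elim a(2)[of n] mult_right_mono[of "a n" "c + 1 / real (Suc n)" "e x"]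
        by (meson less_imp_le order_trans)
      moreover have "(\<lambda>n. (c + 1 / real (Suc n)) * e x) \<longlonglongrightarrow> (c + 0) * e x"
        by (intro tendsto_intros LIMSEQ_Suc[OF lim_1_over_n])
      ultimately show ?case
        using LIMSEQ_le_const by fastforce
    qed
  qed
  define h where "h = (\<lambda>x. c * e x - g x)"
  have h: "h \<in> L"
    unfolding h_def by (intro L_diff L_scale e g)
  have h0: "AE x in M. 0 \<le> h x"
    using cK by eventually_elim (simp add: h_def)
  have h_sub: "AE x in M. B h x \<le> h x"
  proof -
    have "AE x in M. B h x = B (\<lambda>x. c * e x) x - B g x"
      unfolding h_def by (rule posop_diff[OF B L_scale[OF e(1)] g(1)])
    with posop_scale[OF B e(1), of c] e(3) g(3) show ?thesis
      by eventually_elim (simp add: h_def)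
  qed
  have "AE x in M. h x = 0"
  proof (rule ccontr)
    assume nz: "\<not> (AE x in M. h x = 0)"
    obtain m :: nat where m: "AE x in M. e x \<le> real m * h x"
      using superinvariant_le_subinvariant[OF e(1) e_invariant(1) h irreducible[OF h h0 h_sub nz] h_sub]
      by blast
    \<comment> \<open>\<open>Suc m\<close> instead of \<open>m\<close> avoids the division by zero in the case \<open>m = 0\<close>.\<close>
    have "c - 1 / real (Suc m) \<in> K"
      unfolding K_def mem_Collect_eq
      using m h0
    proof eventually_elim
      case (elim x)
      then have "e x \<le> real (Suc m) * h x" by (simp add: algebra_simps)
      then have "e x / real (Suc m) \<le> h x"
        by (simp add: divide_le_eq mult.commute)
      then show ?case by (simp add: h_def algebra_simps)
    qed
    then have "c \<le> c - 1 / real (Suc m)"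
      unfolding c_def by (rule cInf_lower[OF _ bdd])
    then show False by simp
  qed
  then have "AE x in M. g x = c * e x"
    by eventually_elim (simp add: h_def)
  then show ?thesis by blast
qed

text \<open>A function in the kernel of \<open>B\<close> is subinvariant.  If it were nonnegative and nonzero it would
dominate a positive multiple of \<open>e\<close>, and applying \<open>B\<close> would give \<open>e \<le> 0\<close>.\<close>

lemma power_kernel_trivial:
  assumes "u \<in> L" "AE x in M. 0 \<le> u x" "AE x in M. (B ^^ n) u x = 0"
  shows "AE x in M. u x = 0"
  using assms
proof (induction n)
  case (Suc n)
  note Bn = posop_power[OF B, of n]
  have kernel: "AE x in M. w x = 0" if w: "w \<in> L" "AE x in M. 0 \<le> w x" "AE x in M. B w x = 0" for w
  proof (rule ccontr)
    assume nz: "\<not> (AE x in M. w x = 0)"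
    have "AE x in M. B w x \<le> w x"
      using w(2,3) by eventually_elim simp
    then obtain m :: nat where m: "AE x in M. e x \<le> real m * w x"
      using superinvariant_le_subinvariant[OF e(1) e_invariant(1) w(1)] irreducible[OF w(1,2) _ nz]
      by blast
    have "AE x in M. B e x \<le> B (\<lambda>x. real m * w x) x"
      by (rule posop_mono[OF B e(1) L_scale[OF w(1)] m])
    with posop_scale[OF B w(1), of "real m"] w(3) e(2,3)
    have "AE x in M. e x = 0" by eventually_elim simp
    then show False using e(4) by simp
  qed
  have "AE x in M. (B ^^ n) u x = 0"
    using kernel[OF posop_in[OF Bn] posop_nonneg[OF Bn]] Suc.prems by simp
  then show ?case using Suc by blast
qed simp

end


section \<open>Order intervals\<close>

lemma not_tendsto_0_subseq:
  fixes a :: "nat \<Rightarrow> real"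
  assumes "\<not> a \<longlonglongrightarrow> 0" "\<And>n. 0 \<le> a n"
  shows "\<exists>\<epsilon>>0. \<forall>K. \<exists>k\<ge>K. \<epsilon> \<le> a k"
proof (rule ccontr)
  assume neg: "\<not> ?thesis"
  have "\<exists>K. \<forall>k\<ge>K. norm (a k - 0) < \<epsilon>" if "0 < \<epsilon>" for \<epsilon>
    using neg that assms(2) by (metis abs_of_nonneg diff_zero not_le real_norm_def)
  then have "a \<longlonglongrightarrow> 0" by (rule LIMSEQ_I)
  then show False using assms(1) by simp
qed

context real_Lp
begin

text \<open>A positive operator that annihilates no nonzero positive function detects convergence to zero
inside an order interval.  Let \<open>w {m..}\<close> be the supremum of the tail of the sequence.  A
finite supremum of nonnegative functions is at most their sum, so by positivity its image is bounded
in norm by the tail of a geometric series; dominated convergence extends this bound to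
\<open>w {m..}\<close>.  Hence \<open>A\<close>
annihilates the upper limit \<open>v\<close> of the sequence, so \<open>v\<close> vanishes, the sequence tends to zero almost
everywhere, and once more by domination in norm.\<close>

lemma order_interval_fast_limit:
  assumes A: "posop A" and ker: "\<And>u. \<lbrakk>u \<in> L; AE x in M. 0 \<le> u x; AE x in M. A u x = 0\<rbrakk> \<Longrightarrow> AE x in M. u x = 0"
    and g: "g \<in> L" and d: "\<And>k. d k \<in> L" "\<And>k x. 0 \<le> d k x" "\<And>k x. d k x \<le> g x"
    and fast: "\<And>k. nrm (A (d k)) \<le> (1 / 2) ^ k"
  shows "(\<lambda>k. nrm (d k)) \<longlonglongrightarrow> 0"
proof -
  have bdd: "bdd_above ((\<lambda>k. d k x) ` I)" for x I
    using d(3) by (auto intro!: bdd_aboveI)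
  define w where "w I x = (SUP k\<in>I. d k x)" for I :: "nat set" and x
  have w_ge: "d k x \<le> w I x" if "k \<in> I" for k x I
    unfolding w_def using that by (intro cSUP_upper bdd)
  have w_le: "w I x \<le> c" if "I \<noteq> {}" "\<And>k. k \<in> I \<Longrightarrow> d k x \<le> c" for c x I
    unfolding w_def using that by (intro cSUP_least) auto
  have w_nonneg: "0 \<le> w I x" if "I \<noteq> {}" for x I
    using that w_ge d(2) by (meson ex_in_conv order_trans)
  have w_g: "w I x \<le> g x" if "I \<noteq> {}" for x I
    using that d(3) by (intro w_le)
  have w_meas: "w I \<in> borel_measurable M" for I
    unfolding w_def using d(1) bdd by (intro borel_measurable_cSUP) auto
  have w: "w I \<in> L" if "I \<noteq> {}" for I
    using that w_nonneg[OF that] w_g[OF that]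
    by (intro L_dominated(1)[OF g w_meas] AE_I2) (metis abs_ge_self abs_of_nonneg order_trans)
  have A_w: "nrm (A (w {m..})) \<le> 2 * (1 / 2) ^ m" for m
  proof -
    define D where "D n x = w {m..} x - w {m..m + n} x" for n x
    have D: "D n \<in> L" for n
      unfolding D_def by (intro L_diff w) auto
    have "(\<lambda>n. nrm (D n)) \<longlonglongrightarrow> 0"
    proof (rule nrm_dominated_convergence[OF g L_measurable[OF D]])
      show "AE x in M. \<bar>D n x\<bar> \<le> \<bar>g x\<bar>" for n
      proof (rule AE_I2)
        fix x
        have "w {m..m + n} x \<le> w {m..} x"
          by (intro w_le w_ge) auto
        then show "\<bar>D n x\<bar> \<le> \<bar>g x\<bar>"
          unfolding D_def using w_nonneg[of "{m..m + n}" x] w_g[of "{m..}" x] by auto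
      qed
      show "AE x in M. (\<lambda>n. D n x) \<longlonglongrightarrow> 0"
      proof (rule AE_I2, rule LIMSEQ_I)
        fix x :: 'a and \<epsilon> :: real assume "0 < \<epsilon>"
        then have "w {m..} x - \<epsilon> < w {m..} x" by simp
        then obtain k where k: "m \<le> k" "w {m..} x - \<epsilon> < d k x"
          unfolding w_def using less_cSUP_iff[OF _ bdd, of "{m..}"] by auto
        have "norm (D n x - 0) < \<epsilon>" if "k \<le> n" for n
        proof -
          have "d k x \<le> w {m..m + n} x" "w {m..m + n} x \<le> w {m..} x"
            using that k(1) by (intro w_ge w_le; auto intro: w_ge)+
          then show ?thesis using k(2) by (simp add: D_def)
        qed
        then show "\<exists>n0. \<forall>n\<ge>n0. norm (D n x - 0) < \<epsilon>" by blast
      qed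
    qed
    then have "(\<lambda>n. nrm (A (D n))) \<longlonglongrightarrow> 0"
      by (rule posop_limit[OF A D])
    then have lim: "(\<lambda>n. nrm (A (D n)) + 2 * (1 / 2) ^ m) \<longlonglongrightarrow> 0 + 2 * (1 / 2) ^ m"
      by (intro tendsto_intros)
    have "nrm (A (w {m..})) \<le> nrm (A (D n)) + 2 * (1 / 2) ^ m" for n
    proof -
      let ?W = "w {m..m + n}" and ?S = "\<lambda>x. \<Sum>k\<in>{m..m + n}. d k x"
      have W: "?W \<in> L" by (rule w) auto
      have S: "?S \<in> L" by (intro sum_in_L d) auto
      have "AE x in M. 0 \<le> A ?W x"
        by (rule posop_nonneg[OF A W AE_I2], rule w_nonneg) auto
      moreover have "AE x in M. A ?W x \<le> A ?S x"
      proof (rule posop_mono[OF A W S], rule AE_I2)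
        show "?W x \<le> ?S x" for x
          using d(2) by (intro w_le member_le_sum) auto
      qed
      ultimately have "AE x in M. \<bar>A ?W x\<bar> \<le> \<bar>\<Sum>k\<in>{m..m + n}. A (d k) x\<bar>"
        using posop_sum[where u=d, OF A finite_atLeastAtMost d(1), of m "m + n"]
        by eventually_elim auto
      then have "nrm (A ?W) \<le> nrm (\<lambda>x. \<Sum>k\<in>{m..m + n}. A (d k) x)"
        by (intro L_dominated(2) sum_in_L L_measurable posop_in[OF A] W d) auto
      also have "\<dots> \<le> (\<Sum>k\<in>{m..m + n}. nrm (A (d k)))"
        by (intro nrm_sum_le posop_in[OF A] d) auto
      also have "\<dots> \<le> (\<Sum>k\<in>{m..m + n}. (1 / 2) ^ k)"
        by (intro sum_mono fast)
      also have "\<dots> \<le> 2 * (1 / 2) ^ m"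
        by (subst sum_gp) simp
      finally have A_W: "nrm (A ?W) \<le> 2 * (1 / 2) ^ m" .
      have "nrm (A (w {m..})) \<le> nrm (\<lambda>x. A (w {m..}) x - A ?W x) + nrm (A ?W)"
        by (intro nrm_le_diff posop_in[OF A] W w) auto
      also have "nrm (\<lambda>x. A (w {m..}) x - A ?W x) = nrm (A (D n))"
        unfolding D_def by (intro nrm_posop_diff[OF A] w W) auto
      finally show ?thesis using A_W by simp
    qed
    then show ?thesis
      using LIMSEQ_le_const[OF lim] by auto
  qed
  define v where "v x = (INF m. w {m..} x)" for x
  have bdd': "bdd_below (range (\<lambda>m. w {m..} x))" for x
    by (rule bdd_belowI[of _ 0]) (auto intro: w_nonneg)
  have v_le: "v x \<le> w {m..} x" for m x
    unfolding v_def by (intro cINF_lower bdd') auto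
  have v_nonneg: "0 \<le> v x" for x
    unfolding v_def by (intro cINF_greatest w_nonneg) auto
  have v_meas: "v \<in> borel_measurable M"
    unfolding v_def using w_meas bdd' by (intro borel_measurable_cINF) auto
  have v: "v \<in> L"
  proof (rule L_dominated(1)[OF w v_meas AE_I2])
    show "\<bar>v x\<bar> \<le> \<bar>w {0..} x\<bar>" for x
      using v_nonneg[of x] v_le[of x 0] by linarith
  qed auto
  have "AE x in M. A v x = 0"
  proof (rule nrm_limit_eq_0[OF posop_in[OF A v] posop_in[OF A w]])
    show "{m..} \<noteq> {}" for m :: nat by auto
    show "AE x in M. \<bar>A v x\<bar> \<le> \<bar>A (w {m..}) x\<bar>" for m :: nat
    proof -
      have "AE x in M. A v x \<le> A (w {m..}) x"
        by (rule posop_mono[OF A v w AE_I2[OF v_le]]) auto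
      with posop_nonneg[OF A v AE_I2[OF v_nonneg]] show ?thesis
        by eventually_elim auto
    qed
    have "(\<lambda>m. 2 * (1 / 2 :: real) ^ m) \<longlonglongrightarrow> 2 * 0"
      by (intro tendsto_intros LIMSEQ_realpow_zero) auto
    then show "(\<lambda>m. nrm (A (w {m..}))) \<longlonglongrightarrow> 0"
      using A_w by (intro nrm_squeeze[of "\<lambda>m. A (w {m..})" "\<lambda>m. 2 * (1 / 2) ^ m"]) auto
  qed
  then have "AE x in M. v x = 0"
    using ker[OF v] v_nonneg by auto
  then have "AE x in M. (\<lambda>k. d k x) \<longlonglongrightarrow> 0"
  proof eventually_elim
    case (elim x)
    have "decseq (\<lambda>m. w {m..} x)"
      by (intro decseq_SucI w_le w_ge) auto
    then have "(\<lambda>m. w {m..} x) \<longlonglongrightarrow> v x"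
      unfolding v_def by (intro LIMSEQ_decseq_INF bdd')
    then show ?case
      unfolding elim
      by (intro tendsto_sandwich[of "\<lambda>_. 0" "\<lambda>k. d k x" _ "\<lambda>k. w {k..} x"] always_eventually allI)
        (auto intro: d w_ge)
  qed
  then show ?thesis
  proof (rule nrm_dominated_convergence[OF g L_measurable[OF d(1)], rotated])
    show "AE x in M. \<bar>d k x\<bar> \<le> \<bar>g x\<bar>" for k
      using d(2)[of k] order_trans[OF d(3) abs_ge_self] by simp
  qed
qed

text \<open>Otherwise some subsequence stays away from zero, although its images can be chosen to decrease
geometrically.\<close>

lemma order_interval_limit:
  assumes A: "posop A" and ker: "\<And>u. \<lbrakk>u \<in> L; AE x in M. 0 \<le> u x; AE x in M. A u x = 0\<rbrakk> \<Longrightarrow> AE x in M. u x = 0"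
    and g: "g \<in> L" and d: "\<And>k. d k \<in> L" "\<And>k x. 0 \<le> d k x" "\<And>k x. d k x \<le> g x"
    and lim: "(\<lambda>k. nrm (A (d k))) \<longlonglongrightarrow> 0"
  shows "(\<lambda>k. nrm (d k)) \<longlonglongrightarrow> 0"
proof (rule ccontr)
  assume "\<not> ?thesis"
  then obtain \<epsilon> where \<epsilon>: "0 < \<epsilon>" "\<And>K. \<exists>k\<ge>K. \<epsilon> \<le> nrm (d k)"
    using not_tendsto_0_subseq[of "\<lambda>k. nrm (d k)"] by auto
  have "\<exists>k. nrm (A (d k)) \<le> (1 / 2) ^ j \<and> \<epsilon> \<le> nrm (d k)" for j
  proof -
    have "eventually (\<lambda>k. nrm (A (d k)) < (1 / 2) ^ j) sequentially"
      by (rule order_tendstoD(2)[OF lim]) simp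
    then obtain K where "\<And>k. K \<le> k \<Longrightarrow> nrm (A (d k)) < (1 / 2) ^ j"
      by (auto simp: eventually_sequentially)
    then show ?thesis using \<epsilon>(2)[of K] by (meson less_imp_le)
  qed
  then obtain r where r: "\<And>j. nrm (A (d (r j))) \<le> (1 / 2) ^ j" "\<And>j. \<epsilon> \<le> nrm (d (r j))"
    by metis
  have "(\<lambda>j. nrm (d (r j))) \<longlonglongrightarrow> 0"
    by (rule order_interval_fast_limit[OF A ker g d r(1)])
  then have "\<epsilon> \<le> 0"
    by (rule LIMSEQ_le_const) (use r(2) in auto)
  then show False using \<epsilon>(1) by simp
qed

end

section \<open>Superinvariant functions of perturbed operators\<close>

context irreducible_fixed_point
begin

lemma e_power: "AE x in M. (B ^^ n) e x = e x"
proof (induction n)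
  case (Suc n)
  with posop_cong[OF B posop_in[OF posop_power[OF B] e(1)] e(1) Suc] e(3)
  show ?case by eventually_elim simp
qed simp

lemma superinvariant_eq_normalized:
  assumes g: "g \<in> L" "AE x in M. 0 \<le> g x" "AE x in M. g x \<le> B g x" and ng: "nrm g = 1"
  shows "AE x in M. g x = 1 / nrm e * e x"
proof -
  obtain c where c: "AE x in M. g x = c * e x"
    using superinvariant_eq_multiple[OF g] by blast
  have e_norm: "0 < nrm e"
    using nrm_eq_0[OF e(1)] e(4) nrm_nonneg[of e] by (auto simp: less_le)
  have "0 \<le> c"
  proof (rule ccontr)
    assume "\<not> 0 \<le> c"
    have "AE x in M. e x = 0"
      using c g(2) e(2)
    proof eventually_elim
      case (elim x)
      have "c * e x < 0" using elim \<open>\<not> 0 \<le> c\<close> by (intro mult_neg_pos) auto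
      then show ?case using elim by simp
    qed
    then show False using e(4) by simp
  qed
  moreover have "nrm g = \<bar>c\<bar> * nrm e"
    using nrm_cong_AE[OF L_measurable[OF g(1)] L_measurable[OF L_scale[OF e(1)]] c] by (simp add: nrm_scale)
  ultimately have "c = 1 / nrm e"
    using ng e_norm by (simp add: field_simps)
  with c show ?thesis by simp
qed

text \<open>Operators that converge in norm have powers that converge in norm: by induction, the new error is the
image of the old one under \<open>B\<close> plus \<open>s k\<close> times a bounded sequence.\<close>

lemma perturbed_powers_close:
  assumes F: "posop F" and s: "s \<longlonglongrightarrow> 0"
    and Bk: "\<And>k. posop (\<lambda>u x. B u x + s k * F u x)"
    and \<phi>: "\<And>k. \<phi> k \<in> L" "\<And>k. nrm (\<phi> k) \<le> 1"
  shows "(\<lambda>k. nrm (\<lambda>x. ((\<lambda>u x. B u x + s k * F u x) ^^ n) (\<phi> k) x - (B ^^ n) (\<phi> k) x)) \<longlonglongrightarrow> 0"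
proof (induction n)
  case (Suc n)
  define X where "X k = ((\<lambda>u x. B u x + s k * F u x) ^^ n) (\<phi> k)" for k
  define Y where "Y k = (B ^^ n) (\<phi> k)" for k
  have X: "X k \<in> L" and Y: "Y k \<in> L" for k
    unfolding X_def Y_def by (intro posop_in[OF posop_power[OF Bk]] posop_in[OF posop_power[OF B]] \<phi>)+
  have XY: "(\<lambda>k. nrm (\<lambda>x. X k x - Y k x)) \<longlonglongrightarrow> 0"
    unfolding X_def Y_def by (rule Suc.IH)
  obtain C where C: "0 \<le> C" "\<And>u. u \<in> L \<Longrightarrow> nrm ((B ^^ n) u) \<le> C * nrm u"
    using posop_bound[OF posop_power[OF B]] by blast
  obtain C' where C': "0 \<le> C'" "\<And>u. u \<in> L \<Longrightarrow> nrm (F u) \<le> C' * nrm u"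
    using posop_bound[OF F] by blast
  have nY: "nrm (Y k) \<le> C" for k
    using C(2)[OF \<phi>(1)[of k]] mult_left_mono[OF \<phi>(2)[of k] C(1)] unfolding Y_def by linarith
  have bound: "nrm (\<lambda>x. B (X k) x + s k * F (X k) x - B (Y k) x)
      \<le> nrm (B (\<lambda>x. X k x - Y k x)) + \<bar>s k\<bar> * (C' * (nrm (\<lambda>x. X k x - Y k x) + C))" for k
  proof -
    have "nrm (\<lambda>x. B (X k) x + s k * F (X k) x - B (Y k) x)
        \<le> nrm (\<lambda>x. B (X k) x - B (Y k) x) + nrm (\<lambda>x. s k * F (X k) x)"
      using Minkowski(2)[OF L_diff[OF B_in[OF X] B_in[OF Y]] L_scale[OF posop_in[OF F X]], of k k "s k" k]
      by (simp add: algebra_simps)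
    also have "nrm (\<lambda>x. B (X k) x - B (Y k) x) = nrm (B (\<lambda>x. X k x - Y k x))"
      by (rule nrm_posop_diff[OF B X Y])
    also have "nrm (\<lambda>x. s k * F (X k) x) \<le> \<bar>s k\<bar> * (C' * (nrm (\<lambda>x. X k x - Y k x) + C))"
    proof -
      have "nrm (X k) \<le> nrm (\<lambda>x. X k x - Y k x) + C"
        using nrm_le_diff[OF X Y, of k k] nY[of k] by linarith
      then have "nrm (F (X k)) \<le> C' * (nrm (\<lambda>x. X k x - Y k x) + C)"
        using C'(2)[OF X[of k]] mult_left_mono[OF _ C'(1)] by (meson order_trans)
      then show ?thesis unfolding nrm_scale by (intro mult_left_mono) auto
    qed
    finally show ?thesis by simp
  qed
  have "(\<lambda>k. nrm (B (\<lambda>x. X k x - Y k x))) \<longlonglongrightarrow> 0"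
    by (rule posop_limit[OF B L_diff[OF X Y] XY])
  moreover have "(\<lambda>k. \<bar>s k\<bar> * (C' * (nrm (\<lambda>x. X k x - Y k x) + C))) \<longlonglongrightarrow> \<bar>0\<bar> * (C' * (0 + C))"
    by (intro tendsto_intros s XY)
  ultimately have "(\<lambda>k. nrm (B (\<lambda>x. X k x - Y k x)) + \<bar>s k\<bar> * (C' * (nrm (\<lambda>x. X k x - Y k x) + C)))
      \<longlonglongrightarrow> 0 + \<bar>0\<bar> * (C' * (0 + C))"
    by (rule tendsto_add)
  then have "(\<lambda>k. nrm (\<lambda>x. B (X k) x + s k * F (X k) x - B (Y k) x)) \<longlonglongrightarrow> 0"
    by (intro nrm_squeeze[OF bound]) simp
  then show ?case
    by (simp add: X_def Y_def)
qed simp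

text \<open>Write \<open>C\<^sub>k = B + s\<^sub>k F\<close> and \<open>\<psi>\<^sub>k = C\<^sub>k\<^sup>N \<phi>\<^sub>k\<close>, so that \<open>0 \<le> \<phi>\<^sub>k \<le> \<psi>\<^sub>k\<close> and \<open>\<psi>\<^sub>k\<close> has norm one.  By
compactness a subsequence of \<open>\<psi>\<^sub>k\<close> converges to some \<open>g\<close> of norm one, which is nonnegative and
superinvariant under \<open>B\<close> and therefore equals the normalised \<open>e\<close>.  It remains to compare \<open>\<phi>\<^sub>k\<close> with
\<open>g\<close>.  From above, \<open>(\<phi>\<^sub>k - g)\<^sup>+ \<le> \<bar>\<psi>\<^sub>k - g\<bar>\<close> tends to zero.  From below, \<open>(g - \<phi>\<^sub>k)\<^sup>+\<close> stays in the
order interval between \<open>0\<close> and \<open>g\<close>, and its image under \<open>B\<^sup>N\<close> tends to zero because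
\<open>B\<^sup>N \<phi>\<^sub>k\<close> tends to \<open>g = B\<^sup>N g\<close>; as \<open>B\<^sup>N\<close> annihilates no nonzero positive function, it tends to zero as
well.  Since every subsequence can be treated in this way, the whole sequence converges.\<close>

theorem perturbed_superinvariant_tendsto:
  assumes F: "posop F" and s: "s \<longlonglongrightarrow> 0"
    and Bk: "\<And>k. posop (\<lambda>u x. B u x + s k * F u x)"
    and \<phi>: "\<And>k. \<phi> k \<in> L" "\<And>k. AE x in M. 0 \<le> \<phi> k x"
    and super: "\<And>k. AE x in M. \<phi> k x \<le> B (\<phi> k) x + s k * F (\<phi> k) x"
    and normalized: "\<And>k. nrm (((\<lambda>u x. B u x + s k * F u x) ^^ N) (\<phi> k)) = 1"
  shows "(\<lambda>k. nrm (\<lambda>x. \<phi> k x - 1 / nrm e * e x)) \<longlonglongrightarrow> 0"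
proof (rule ccontr)
  assume "\<not> ?thesis"
  then obtain \<epsilon> where \<epsilon>: "0 < \<epsilon>" "\<And>K. \<exists>k\<ge>K. \<epsilon> \<le> nrm (\<lambda>x. \<phi> k x - 1 / nrm e * e x)"
    using not_tendsto_0_subseq[of "\<lambda>k. nrm (\<lambda>x. \<phi> k x - 1 / nrm e * e x)"] by auto
  then obtain r0 where r0: "\<And>j. j \<le> r0 j" "\<And>j. \<epsilon> \<le> nrm (\<lambda>x. \<phi> (r0 j) x - 1 / nrm e * e x)"
    by metis
  define C where "C k = (\<lambda>u x. B u x + s k * F u x)" for k
  note C = Bk[folded C_def]
  have C_in: "(C k ^^ n) (\<phi> k) \<in> L" for k n
    by (rule posop_in[OF posop_power[OF C] \<phi>(1)])
  define \<psi> where "\<psi> k = (C k ^^ N) (\<phi> k)" for k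
  have \<psi>: "\<psi> k \<in> L" for k
    unfolding \<psi>_def by (rule C_in)
  have n\<psi>: "nrm (\<psi> k) = 1" for k
    unfolding \<psi>_def C_def by (rule normalized)
  have super': "AE x in M. \<phi> k x \<le> C k (\<phi> k) x" for k
    using super[of k] by (simp add: C_def)
  have \<phi>\<psi>: "AE x in M. \<phi> k x \<le> \<psi> k x" for k
    unfolding \<psi>_def by (rule superinvariant_power[OF C \<phi>(1) super'])
  have \<psi>_super: "AE x in M. \<psi> k x \<le> (C k ^^ Suc N) (\<phi> k) x" for k
    unfolding \<psi>_def funpow_Suc_right comp_apply
    by (rule posop_mono[OF posop_power[OF C] \<phi>(1) posop_in[OF C \<phi>(1)] super'])
  have n\<phi>: "nrm (\<phi> k) \<le> 1" for k
  proof -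
    have "AE x in M. \<bar>\<phi> k x\<bar> \<le> \<bar>\<psi> k x\<bar>"
      using \<phi>\<psi>[of k] \<phi>(2)[of k] by eventually_elim auto
    then show ?thesis
      using L_dominated(2)[OF \<psi> L_measurable[OF \<phi>(1)]] n\<psi> by metis
  qed
  obtain r1 g where r1: "strict_mono r1" and g: "g \<in> L"
    and lim0: "(\<lambda>j. nrm (\<lambda>x. (B ^^ N) (\<phi> (r0 (r1 j))) x - g x)) \<longlonglongrightarrow> 0"
    using compact[of "\<lambda>j. \<phi> (r0 j)" 1] \<phi>(1) n\<phi> by blast
  define r where "r j = r0 (r1 j)" for j
  have "filterlim r sequentially sequentially"
    unfolding filterlim_at_top
  proof
    fix K
    have "K \<le> r j" if "K \<le> j" for j
      using that seq_suble[OF r1, of j] r0(1)[of "r1 j"] by (simp add: r_def)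
    then show "eventually (\<lambda>j. K \<le> r j) sequentially"
      by (auto simp: eventually_sequentially)
  qed
  note sub = filterlim_compose[OF _ this]
  have close: "(\<lambda>j. nrm (\<lambda>x. (C (r j) ^^ n) (\<phi> (r j)) x - (B ^^ n) (\<phi> (r j)) x)) \<longlonglongrightarrow> 0" for n
    using perturbed_powers_close[OF F s Bk \<phi>(1) n\<phi>, of n] sub
    unfolding C_def by fast
  have lim: "(\<lambda>j. nrm (\<lambda>x. (B ^^ N) (\<phi> (r j)) x - g x)) \<longlonglongrightarrow> 0"
    unfolding r_def by (rule lim0)
  have lim\<psi>: "(\<lambda>j. nrm (\<lambda>x. \<psi> (r j) x - g x)) \<longlonglongrightarrow> 0"
    using tendsto_add[OF close[of N] lim]
    by (intro nrm_squeeze[where u="\<lambda>j x. \<psi> (r j) x - g x", OF nrm_triangle[OF \<psi> BN_in[OF \<phi>(1)] g]])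
      (simp add: \<psi>_def)
  have limB: "(\<lambda>j. nrm (\<lambda>x. (C (r j) ^^ Suc N) (\<phi> (r j)) x - B g x)) \<longlonglongrightarrow> 0"
  proof -
    have "(\<lambda>j. nrm (B (\<lambda>x. (B ^^ N) (\<phi> (r j)) x - g x))) \<longlonglongrightarrow> 0"
      by (rule posop_limit[OF B L_diff[OF BN_in[OF \<phi>(1)] g] lim])
    then have "(\<lambda>j. nrm (\<lambda>x. (B ^^ Suc N) (\<phi> (r j)) x - B g x)) \<longlonglongrightarrow> 0"
      using nrm_posop_diff[OF B BN_in[OF \<phi>(1)] g] by simp
    from tendsto_add[OF close[of "Suc N"] this]
    have "(\<lambda>j. nrm (\<lambda>x. (C (r j) ^^ Suc N) (\<phi> (r j)) x - (B ^^ Suc N) (\<phi> (r j)) x)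
        + nrm (\<lambda>x. (B ^^ Suc N) (\<phi> (r j)) x - B g x)) \<longlonglongrightarrow> 0"
      by (simp only: add_0_right)
    then show ?thesis
      by (rule nrm_squeeze[rotated])
        (intro nrm_triangle C_in posop_in[OF posop_power[OF B]] \<phi> B_in g)
  qed
  have ng: "nrm g = 1"
  proof -
    have "(\<lambda>j. nrm (\<psi> (r j)) - nrm g) \<longlonglongrightarrow> 0"
    proof (rule Lim_null_comparison[OF _ lim\<psi>], rule always_eventually, rule allI)
      fix j
      show "norm (nrm (\<psi> (r j)) - nrm g) \<le> nrm (\<lambda>x. \<psi> (r j) x - g x)"
        using nrm_le_diff[OF \<psi> g, of "r j"] nrm_le_diff[OF g \<psi>, of "r j"] nrm_minus[of g "\<psi> (r j)"]
        by auto
    qed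
    then show ?thesis by (simp add: n\<psi> LIMSEQ_const_iff)
  qed
  have g_nonneg: "AE x in M. 0 \<le> g x"
  proof -
    have "AE x in M. max 0 (0 - g x) = 0"
    proof (rule nrm_limit_eq_0[OF _ L_diff[OF \<psi> g] _ lim\<psi>])
      show "(\<lambda>x. max 0 (0 - g x)) \<in> L"
        by (intro L_pos_part L_diff L_zero g)
      show "AE x in M. \<bar>max 0 (0 - g x)\<bar> \<le> \<bar>\<psi> (r j) x - g x\<bar>" for j
        using \<phi>(2)[of "r j"] \<phi>\<psi>[of "r j"] by eventually_elim auto
    qed
    then show ?thesis by eventually_elim auto
  qed
  have g_super: "AE x in M. g x \<le> B g x"
  proof -
    let ?d = "\<lambda>x. max 0 (g x - B g x)"
    have d: "?d \<in> L" by (intro L_pos_part L_diff g B_in)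
    have "nrm ?d \<le> nrm (\<lambda>x. \<psi> (r j) x - g x) + nrm (\<lambda>x. (C (r j) ^^ Suc N) (\<phi> (r j)) x - B g x)" for j
      using \<psi>_super[of "r j"]
      by (intro nrm_le_add[OF d L_diff[OF \<psi> g] L_diff[OF C_in B_in[OF g]]], eventually_elim) auto
    moreover have "(\<lambda>j. nrm (\<lambda>x. \<psi> (r j) x - g x) + nrm (\<lambda>x. (C (r j) ^^ Suc N) (\<phi> (r j)) x - B g x)) \<longlonglongrightarrow> 0"
      using tendsto_add[OF lim\<psi> limB] by simp
    ultimately have "nrm ?d \<le> 0"
      using LIMSEQ_le_const by blast
    then have "AE x in M. ?d x = 0"
      using nrm_nonneg[of ?d] by (intro nrm_eq_0[OF d]) linarith
    then show ?thesis by eventually_elim auto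
  qed
  have c: "AE x in M. g x = 1 / nrm e * e x"
    by (rule superinvariant_eq_normalized[OF g g_nonneg g_super ng])
  define f where "f = (\<lambda>x. 1 / nrm e * e x)"
  have gf: "AE x in M. g x = f x"
    using c by (simp add: f_def)
  have f: "f \<in> L"
    unfolding f_def by (intro L_scale e)
  have gBf: "AE x in M. g x = (B ^^ N) f x"
    unfolding f_def using posop_scale[OF BN e(1), of "1 / nrm e"] e_power[of N] c
    by eventually_elim simp
  define z where "z j x = max 0 (\<phi> (r j) x - f x)" for j x
  \<comment> \<open>The inner \<open>max\<close> makes the bounds on \<open>d\<close> hold at every point, as suprema of uncontrolled
    representatives need not exist.\<close>
  define d where "d j x = max 0 (f x - max 0 (\<phi> (r j) x))" for j x
  have z: "z j \<in> L" and d: "d j \<in> L" for j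
    unfolding z_def d_def by (intro L_pos_part L_diff \<phi> f)+
  have limz: "(\<lambda>j. nrm (z j)) \<longlonglongrightarrow> 0"
  proof (rule nrm_squeeze[OF _ lim\<psi>])
    show "nrm (z j) \<le> nrm (\<lambda>x. \<psi> (r j) x - g x)" for j
    proof (rule L_dominated(2)[OF L_diff[OF \<psi> g] L_measurable[OF z]])
      show "AE x in M. \<bar>z j x\<bar> \<le> \<bar>\<psi> (r j) x - g x\<bar>"
        using \<phi>\<psi>[of "r j"] gf by eventually_elim (auto simp: z_def)
    qed
  qed
  have limd: "(\<lambda>j. nrm (d j)) \<longlonglongrightarrow> 0"
  proof (rule order_interval_limit[OF BN power_kernel_trivial L_pos_part[OF f] d])
    show "(\<lambda>j. nrm ((B ^^ N) (d j))) \<longlonglongrightarrow> 0"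
    proof (rule nrm_squeeze)
      show "nrm ((B ^^ N) (d j)) \<le> nrm (\<lambda>x. (B ^^ N) (\<phi> (r j)) x - g x) + nrm ((B ^^ N) (z j))" for j
      proof (rule nrm_le_add[OF BN_in[OF d] L_diff[OF BN_in[OF \<phi>(1)] g] BN_in[OF z]])
        have "AE x in M. d j x = (f x - \<phi> (r j) x) + z j x"
          using \<phi>(2)[of "r j"] by eventually_elim (auto simp: d_def z_def)
        then have "AE x in M. (B ^^ N) (d j) x = (B ^^ N) (\<lambda>x. (f x - \<phi> (r j) x) + z j x) x"
          by (intro posop_cong[OF BN d] Minkowski L_diff f \<phi> z)
        moreover have "AE x in M. (B ^^ N) (\<lambda>x. (f x - \<phi> (r j) x) + z j x) x
            = (B ^^ N) (\<lambda>x. f x - \<phi> (r j) x) x + (B ^^ N) (z j) x"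
          by (intro posop_add[OF BN] L_diff f \<phi> z)
        moreover have "AE x in M. (B ^^ N) (\<lambda>x. f x - \<phi> (r j) x) x = (B ^^ N) f x - (B ^^ N) (\<phi> (r j)) x"
          by (intro posop_diff[OF BN] f \<phi>)
        ultimately show "AE x in M. \<bar>(B ^^ N) (d j) x\<bar> \<le> \<bar>(B ^^ N) (\<phi> (r j)) x - g x\<bar> + \<bar>(B ^^ N) (z j) x\<bar>"
          using gBf by eventually_elim auto
      qed
      show "(\<lambda>j. nrm (\<lambda>x. (B ^^ N) (\<phi> (r j)) x - g x) + nrm ((B ^^ N) (z j))) \<longlonglongrightarrow> 0"
        using tendsto_add[OF lim posop_limit[OF BN z limz]] by simp
    qed
  qed (auto simp: d_def)
  have "(\<lambda>j. nrm (\<lambda>x. \<phi> (r j) x - f x)) \<longlonglongrightarrow> 0"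
  proof (rule nrm_squeeze)
    show "nrm (\<lambda>x. \<phi> (r j) x - f x) \<le> nrm (z j) + nrm (d j)" for j
      using \<phi>(2)[of "r j"]
      by (intro nrm_le_add[OF L_diff[OF \<phi>(1) f] z d], eventually_elim) (auto simp: z_def d_def)
    show "(\<lambda>j. nrm (z j) + nrm (d j)) \<longlonglongrightarrow> 0"
      using tendsto_add[OF limz limd] by simp
  qed
  then have "\<epsilon> \<le> 0"
    by (rule LIMSEQ_le_const) (use r0(2) in \<open>auto simp: r_def f_def\<close>)
  then show False using \<epsilon>(1) by simp
qed

end


section \<open>Real representatives of operators on complex functions\<close>

locale Lp_exponent =
  fixes M :: "'a measure" and p :: ennreal
  assumes p: "1 \<le> p" "p < \<infinity>"

sublocale Lp_exponent \<subseteq> real_Lp M "enn2real p"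
proof
  show "1 \<le> enn2real p"
    using enn2real_mono[of 1 p] p by simp
qed

context Lp_exponent
begin

abbreviation cplx :: "('a \<Rightarrow> real) \<Rightarrow> 'a cfun" where
  "cplx u \<equiv> \<lambda>x. complex_of_real (u x)"

lemma Lp_iff: "f \<in> Lp M p \<longleftrightarrow> f \<in> borel_measurable M \<and> (\<lambda>x. norm (f x)) \<in> L"
  using p by (auto simp: Lp_def L_def)

lemma Lp_norm_eq: "Lp_norm M p f = nrm (\<lambda>x. norm (f x))"
  using p by (auto simp: Lp_norm_def nrm_def)

lemma cplx_Lp: "u \<in> L \<Longrightarrow> cplx u \<in> Lp M p"
  by (auto simp: Lp_iff L_abs dest!: L_measurable)

lemma Lp_norm_cplx: "Lp_norm M p (cplx u) = nrm u"
  by (simp add: Lp_norm_eq nrm_abs)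

lemma Re_L: "f \<in> Lp M p \<Longrightarrow> (\<lambda>x. Re (f x)) \<in> L"
  and nrm_Re_le: "f \<in> Lp M p \<Longrightarrow> nrm (\<lambda>x. Re (f x)) \<le> Lp_norm M p f"
  unfolding Lp_iff Lp_norm_eq
  by (auto intro!: L_dominated[where u="\<lambda>x. norm (f x)"] simp: abs_Re_le_cmod)

lemma Lp_add: "f \<in> Lp M p \<Longrightarrow> g \<in> Lp M p \<Longrightarrow> (\<lambda>x. f x + g x) \<in> Lp M p"
  unfolding Lp_iff
  by (auto intro!: L_dominated(1)[OF Minkowski(1), of "\<lambda>x. norm (f x)" "\<lambda>x. norm (g x)"] norm_triangle_ineq)

lemma Lp_scale: "f \<in> Lp M p \<Longrightarrow> (\<lambda>x. c * f x) \<in> Lp M p"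
  unfolding Lp_iff by (auto simp: norm_mult intro!: L_scale)

lemma Lp_diff: "f \<in> Lp M p \<Longrightarrow> g \<in> Lp M p \<Longrightarrow> (\<lambda>x. f x - g x) \<in> Lp M p"
  using Lp_add[of f "\<lambda>x. (-1) * g x"] Lp_scale[of g "-1"] by simp

lemma Lp_norm_cong_AE:
  assumes "f \<in> Lp M p" "u \<in> L" "AE x in M. f x = cplx u x"
  shows "Lp_norm M p f = nrm u"
proof -
  have "nrm (\<lambda>x. norm (f x)) = nrm (\<lambda>x. \<bar>u x\<bar>)"
    by (rule nrm_cong_AE) (use assms in \<open>auto simp: Lp_iff\<close>)
  then show ?thesis by (simp add: Lp_norm_eq nrm_abs)
qed

lemma
  assumes "bounded_op M p A"
  shows bounded_op_in: "f \<in> Lp M p \<Longrightarrow> A f \<in> Lp M p"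
    and bounded_op_add: "f \<in> Lp M p \<Longrightarrow> g \<in> Lp M p \<Longrightarrow> AE x in M. A (\<lambda>x. f x + g x) x = A f x + A g x"
    and bounded_op_scale: "f \<in> Lp M p \<Longrightarrow> AE x in M. A (\<lambda>x. c * f x) x = c * A f x"
    and bounded_op_cong: "f \<in> Lp M p \<Longrightarrow> g \<in> Lp M p \<Longrightarrow> AE x in M. f x = g x \<Longrightarrow> AE x in M. A f x = A g x"
    and bounded_op_bound: "\<exists>C. \<forall>f\<in>Lp M p. Lp_norm M p (A f) \<le> C * Lp_norm M p f"
  using assms unfolding bounded_op_def lin_op_def ae_eq_def by blast+

text \<open>A nonnegative operator on complex functions preserves real functions, being additive, so its
restriction to them is a positive operator in the real sense.\<close>

definition realify :: "'a operator \<Rightarrow> ('a \<Rightarrow> real) \<Rightarrow> ('a \<Rightarrow> real)" where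
  "realify A u = (\<lambda>x. Re (A (cplx u) x))"

text \<open>Stated for all complex \<open>f\<close> that agree with a real function almost everywhere, and not only for real
ones, so that the relation is closed under composition.\<close>

definition represented :: "'a operator \<Rightarrow> (('a \<Rightarrow> real) \<Rightarrow> ('a \<Rightarrow> real)) \<Rightarrow> bool" where
  "represented A A' \<longleftrightarrow> (\<forall>f\<in>Lp M p. \<forall>u\<in>L. (AE x in M. f x = cplx u x) \<longrightarrow>
     A f \<in> Lp M p \<and> A' u \<in> L \<and> (AE x in M. A f x = cplx (A' u) x))"

lemma representedD:
  assumes "represented A A'" "f \<in> Lp M p" "u \<in> L" "AE x in M. f x = cplx u x"
  shows "A f \<in> Lp M p" "A' u \<in> L" "AE x in M. A f x = cplx (A' u) x"
  using assms unfolding represented_def by blast+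

lemma represented_comp:
  assumes A: "represented A A'" and C: "represented C C'"
  shows "represented (A \<circ> C) (A' \<circ> C')"
  unfolding represented_def comp_apply
proof (intro ballI impI)
  fix f u assume "f \<in> Lp M p" "u \<in> L" "AE x in M. f x = cplx u x"
  from representedD[OF A representedD[OF C this]]
  show "A (C f) \<in> Lp M p \<and> A' (C' u) \<in> L \<and> (AE x in M. A (C f) x = cplx (A' (C' u)) x)"
    by simp
qed

lemma represented_power: "represented A A' \<Longrightarrow> represented (A ^^ n) (A' ^^ n)"
proof (induction n)
  case 0
  show ?case by (simp add: represented_def)
next
  case (Suc n)
  then show ?case unfolding funpow.simps by (intro represented_comp)
qed

lemma realify_real:
  assumes A: "bounded_op M p A" "nonneg_op M p A" and u: "u \<in> L"
  shows "AE x in M. A (cplx u) x = cplx (realify A u) x"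
proof -
  have real: "AE x in M. A (cplx v) x \<in> \<real>" if "v \<in> L" "\<And>x. 0 \<le> v x" for v
  proof -
    have "nonneg_fun M (A (cplx v))"
      using A(2) cplx_Lp[OF that(1)] that(2) unfolding nonneg_op_def nonneg_fun_def by auto
    then show ?thesis unfolding nonneg_fun_def by eventually_elim simp
  qed
  define v w where "v x = max 0 (u x)" and "w x = max 0 (0 - u x)" for x
  have v: "v \<in> L" and w: "w \<in> L"
    unfolding v_def w_def by (intro L_pos_part L_diff L_zero u)+
  have "cplx u = (\<lambda>x. cplx v x + (-1) * cplx w x)"
    by (auto simp: v_def w_def max_def)
  then have "AE x in M. A (cplx u) x = A (cplx v) x + A (\<lambda>x. (-1) * cplx w x) x"
    using bounded_op_add[OF A(1) cplx_Lp[OF v] Lp_scale[OF cplx_Lp[OF w], of "-1"]] by metis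
  moreover have "AE x in M. A (\<lambda>x. (-1) * cplx w x) x = (-1) * A (cplx w) x"
    by (rule bounded_op_scale[OF A(1) cplx_Lp[OF w]])
  moreover have "AE x in M. A (cplx v) x \<in> \<real>" "AE x in M. A (cplx w) x \<in> \<real>"
    using real[OF v] real[OF w] by (simp_all add: v_def w_def)
  ultimately show ?thesis
  proof eventually_elim
    case (elim x)
    then have "A (cplx u) x \<in> \<real>" by auto
    then show ?case by (simp add: realify_def)
  qed
qed

lemma realify_represented:
  assumes A: "bounded_op M p A" "nonneg_op M p A"
  shows "represented A (realify A)"
  unfolding represented_def
proof (intro ballI impI conjI)
  fix f u assume f: "f \<in> Lp M p" and u: "u \<in> L" and eq: "AE x in M. f x = cplx u x"
  show "A f \<in> Lp M p" by (rule bounded_op_in[OF A(1) f])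
  show "realify A u \<in> L"
    unfolding realify_def by (rule Re_L[OF bounded_op_in[OF A(1) cplx_Lp[OF u]]])
  show "AE x in M. A f x = cplx (realify A u) x"
    using bounded_op_cong[OF A(1) f cplx_Lp[OF u] eq] realify_real[OF A u] by eventually_elim simp
qed

lemma posop_realify:
  assumes A: "bounded_op M p A" "nonneg_op M p A"
  shows "posop (realify A)"
  unfolding posop_def
proof (intro conjI ballI allI impI)
  fix u assume u: "u \<in> L"
  then show "realify A u \<in> L"
    unfolding realify_def by (intro Re_L bounded_op_in[OF A(1)] cplx_Lp)
next
  fix u v assume uv: "u \<in> L" "v \<in> L"
  show "AE x in M. realify A (\<lambda>x. u x + v x) x = realify A u x + realify A v x"
    using bounded_op_add[OF A(1) cplx_Lp[OF uv(1)] cplx_Lp[OF uv(2)]]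
    unfolding realify_def of_real_add by eventually_elim simp
next
  fix c u assume u: "u \<in> L"
  show "AE x in M. realify A (\<lambda>x. c * u x) x = c * realify A u x"
    using bounded_op_scale[OF A(1) cplx_Lp[OF u], of "complex_of_real c"]
    unfolding realify_def of_real_mult by eventually_elim simp
next
  fix u assume u: "u \<in> L" "AE x in M. 0 \<le> u x"
  have "nonneg_fun M (A (cplx u))"
    using A(2) cplx_Lp[OF u(1)] u(2) unfolding nonneg_op_def nonneg_fun_def by auto
  then show "AE x in M. 0 \<le> realify A u x"
    unfolding nonneg_fun_def realify_def by eventually_elim simp
next
  obtain C where C: "\<And>f. f \<in> Lp M p \<Longrightarrow> Lp_norm M p (A f) \<le> C * Lp_norm M p f"
    using bounded_op_bound[OF A(1)] by blast
  have "nrm (realify A u) \<le> max 0 C * nrm u" if u: "u \<in> L" for u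
  proof -
    have "nrm (realify A u) \<le> Lp_norm M p (A (cplx u))"
      unfolding realify_def by (intro nrm_Re_le bounded_op_in[OF A(1)] cplx_Lp u)
    also have "\<dots> \<le> C * nrm u"
      using C[OF cplx_Lp[OF u]] by (simp add: Lp_norm_cplx)
    also have "\<dots> \<le> max 0 C * nrm u"
      by (intro mult_right_mono) auto
    finally show ?thesis .
  qed
  then show "\<exists>C\<ge>0. \<forall>u\<in>L. nrm (realify A u) \<le> C * nrm u"
    by (intro exI[of _ "max 0 C"]) auto
qed

section \<open>Nonnegativity, critical values and irreducibility\<close>

text \<open>A nonnegative function is the limit of the strictly positive functions \<open>f + h / n\<close>.\<close>

lemma nonneg_op_if_pos_preserving:
  assumes R: "bounded_op M p R" and R_pos: "\<And>f. f \<in> Lp_pos M p \<Longrightarrow> R f \<in> Lp_pos M p"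
    and h: "h \<in> Lp_pos M p"
  shows "nonneg_op M p R"
  unfolding nonneg_op_def
proof (intro ballI impI)
  fix f assume f: "f \<in> Lp M p" "nonneg_fun M f"
  have hLp: "h \<in> Lp M p" and h_pos: "AE x in M. h x \<in> \<real> \<and> 0 < Re (h x)"
    using h by (auto simp: Lp_pos_def)
  define c :: "nat \<Rightarrow> complex" where "c n = complex_of_real (1 / real (Suc n))" for n
  have pos: "AE x in M. R f x + c n * R h x \<in> \<real> \<and> 0 < Re (R f x + c n * R h x)" for n
  proof -
    have in_pos: "(\<lambda>x. f x + c n * h x) \<in> Lp_pos M p"
      unfolding Lp_pos_def mem_Collect_eq
    proof
      show "AE x in M. f x + c n * h x \<in> \<real> \<and> 0 < Re (f x + c n * h x)"
        using f(2)[unfolded nonneg_fun_def] h_pos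
      proof eventually_elim
        case (elim x)
        then have "0 < 1 / real (Suc n) * Re (h x)" by simp
        then have "0 < Re (f x + c n * h x)"
          using elim unfolding c_def by (auto simp del: of_nat_Suc intro: add_nonneg_pos)
        then show ?case
          using elim unfolding c_def by (auto intro!: Reals_add Reals_mult)
      qed
    qed (intro Lp_add Lp_scale f hLp)
    have "AE x in M. R (\<lambda>x. f x + c n * h x) x \<in> \<real> \<and> 0 < Re (R (\<lambda>x. f x + c n * h x) x)"
      using R_pos[OF in_pos] by (simp add: Lp_pos_def)
    with bounded_op_add[OF R f(1) Lp_scale[OF hLp, of "c n"]] bounded_op_scale[OF R hLp, of "c n"]
    show ?thesis by eventually_elim simp
  qed
  then have "AE x in M. \<forall>n. R f x + c n * R h x \<in> \<real> \<and> 0 < Re (R f x + c n * R h x)"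
    by (simp add: AE_all_countable)
  then show "nonneg_fun M (R f)"
    unfolding nonneg_fun_def
  proof eventually_elim
    case (elim x)
    have "c \<longlonglongrightarrow> complex_of_real 0"
      unfolding c_def by (intro tendsto_of_real LIMSEQ_Suc[OF lim_1_over_n])
    then have lim: "(\<lambda>n. R f x + c n * R h x) \<longlonglongrightarrow> R f x + complex_of_real 0 * R h x"
      by (intro tendsto_intros)
    have "R f x \<in> \<real>"
      using closed_sequentially[OF closed_complex_Reals _ lim] elim by simp
    moreover have "0 \<le> Re (R f x)"
      using LIMSEQ_le_const[OF tendsto_Re[OF lim], of 0] elim by (auto intro: less_imp_le)
    ultimately show ?case by simp
  qed
qed

text \<open>The supremum that defines \<open>\<tau>\<^sub>+\<close> is attained when it is positive and finite: the admissible values contain a sequence converging to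
it, and the defining inequality passes to the limit outside a countable union of null sets.\<close>

lemma nonneg_at_tau_plus:
  assumes \<gamma>: "0 < \<gamma>" and tau: "tau_plus M T Ks Kf \<phi> = ennreal \<gamma>"
  shows "nonneg_fun M (op_add T (K_op Ks Kf \<gamma>) \<phi>)"
proof -
  let ?G = "{\<gamma>::real. 0 < \<gamma> \<and> nonneg_fun M (op_add T (K_op Ks Kf \<gamma>) \<phi>)}"
  have upper: "t \<le> \<gamma>" if "t \<in> ?G" for t
  proof -
    have "ennreal t \<le> ennreal \<gamma>"
      unfolding tau[symmetric] tau_plus_def using that by (intro SUP_upper)
    then show ?thesis using \<gamma> by simp
  qed
  have "\<exists>t\<in>?G. \<gamma> - 1 / real (Suc n) < t" for n
  proof -
    have "ennreal (\<gamma> - 1 / real (Suc n)) < ennreal \<gamma>"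
      using \<gamma> by (intro ennreal_lessI) auto
    then obtain t where t: "t \<in> ?G" "ennreal (\<gamma> - 1 / real (Suc n)) < ennreal t"
      unfolding tau[symmetric] tau_plus_def less_SUP_iff by blast
    then have "\<gamma> - 1 / real (Suc n) < t"
      by (meson ennreal_leI not_le)
    with t(1) show ?thesis by blast
  qed
  then obtain t where t: "\<And>n. t n \<in> ?G" "\<And>n. \<gamma> - 1 / real (Suc n) < t n"
    by metis
  have "(\<lambda>n. \<gamma> - 1 / real (Suc n)) \<longlonglongrightarrow> \<gamma> - 0"
    by (intro tendsto_intros LIMSEQ_Suc[OF lim_1_over_n])
  then have t_lim: "t \<longlonglongrightarrow> \<gamma>"
    using upper[OF t(1)] less_imp_le[OF t(2)]
    by (intro tendsto_sandwich[of "\<lambda>n. \<gamma> - 1 / real (Suc n)" t _ "\<lambda>_. \<gamma>"] always_eventually allI) auto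
  have "AE x in M. \<forall>n. op_add T (K_op Ks Kf (t n)) \<phi> x \<in> \<real> \<and> 0 \<le> Re (op_add T (K_op Ks Kf (t n)) \<phi> x)"
    using t(1) by (simp add: AE_all_countable nonneg_fun_def)
  then show ?thesis
    unfolding nonneg_fun_def
  proof eventually_elim
    case (elim x)
    have lim: "(\<lambda>n. op_add T (K_op Ks Kf (t n)) \<phi> x) \<longlonglongrightarrow> op_add T (K_op Ks Kf \<gamma>) \<phi> x"
      unfolding op_add_def K_op_def op_scale_def using \<gamma> by (intro tendsto_intros t_lim) auto
    have "op_add T (K_op Ks Kf \<gamma>) \<phi> x \<in> \<real>"
      using closed_sequentially[OF closed_complex_Reals _ lim] elim by simp
    moreover have "0 \<le> Re (op_add T (K_op Ks Kf \<gamma>) \<phi> x)"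
      using LIMSEQ_le_const[OF tendsto_Re[OF lim], of 0] elim by auto
    ultimately show ?case by simp
  qed
qed

text \<open>As \<open>F \<le> c B\<close> and \<open>B u \<le> u\<close>, it follows that \<open>F\<^sup>n u \<le> c\<^sup>n u\<close> for every \<open>n\<close>, so
all iterates vanish where \<open>u\<close> does, and testing against the indicator of a subset of \<open>{u = 0}\<close> contradicts irreducibility.  The function \<open>h\<close> supplies
a subset of finite positive measure: one of the sets where it exceeds \<open>1 / k\<close>.  Its indicator lies
in every Lebesgue space, so the argument is the same for all \<open>q\<close>.\<close>

lemma subinvariant_pos:
  assumes irred: "irreducible_op M p q A" and rep: "represented A F" and F: "posop F" and B: "posop B"
    and c: "0 \<le> c" and FB: "\<And>u. u \<in> L \<Longrightarrow> AE x in M. 0 \<le> u x \<Longrightarrow> AE x in M. F u x \<le> c * B u x"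
    and h: "h \<in> L" "AE x in M. 0 < h x"
    and u: "u \<in> L" "AE x in M. 0 \<le> u x" "AE x in M. B u x \<le> u x" "\<not> (AE x in M. u x = 0)"
  shows "AE x in M. 0 < u x"
proof (rule ccontr)
  assume not_pos: "\<not> (AE x in M. 0 < u x)"
  have Fn: "posop (F ^^ n)" for n by (rule posop_power[OF F])
  have F_le: "AE x in M. (F ^^ n) u x \<le> c ^ n * u x" for n
  proof (induction n)
    case (Suc n)
    have "AE x in M. F ((F ^^ n) u) x \<le> F (\<lambda>x. c ^ n * u x) x"
      by (rule posop_mono[OF F posop_in[OF Fn u(1)] L_scale[OF u(1)] Suc])
    with posop_scale[OF F u(1), of "c ^ n"] FB[OF u(1,2)] u(3)
    show ?case
    proof eventually_elim
      case (elim x)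
      have "F u x \<le> c * u x"
        using elim mult_left_mono[OF elim(3) c] by linarith
      then have "c ^ n * F u x \<le> c ^ n * (c * u x)"
        using c by (intro mult_left_mono) auto
      then show ?case using elim by (simp add: mult.assoc mult.left_commute)
    qed
  qed simp
  have [measurable]: "u \<in> borel_measurable M" "h \<in> borel_measurable M"
    using u h by auto
  define Z where "Z k = {x \<in> space M. u x \<le> 0 \<and> 1 / real (Suc k) \<le> h x}" for k
  have [measurable]: "Z k \<in> sets M" for k
    unfolding Z_def by measurable
  have "\<exists>k. \<not> (AE x in M. x \<notin> Z k)"
  proof (rule ccontr)
    assume "\<nexists>k. \<not> (AE x in M. x \<notin> Z k)"
    then have "AE x in M. \<forall>k. x \<notin> Z k"
      by (simp add: AE_all_countable)
    with h(2) AE_space have "AE x in M. 0 < u x"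
    proof eventually_elim
      case (elim x)
      obtain k where "inverse (real (Suc k)) < h x"
        using reals_Archimedean[OF elim(1)] by blast
      with elim show ?case
        unfolding Z_def by (auto simp: inverse_eq_divide not_le dest!: spec[of _ k])
    qed
    with not_pos show False by simp
  qed
  then obtain k where k: "\<not> (AE x in M. x \<notin> Z k)" by blast
  define \<psi> where "\<psi> x = (indicator (Z k) x :: complex)" for x
  have \<psi>_meas: "\<psi> \<in> borel_measurable M"
    unfolding \<psi>_def by measurable
  have "integrable M (\<lambda>x. indicator (Z k) x :: real)"
  proof (rule Bochner_Integration.integrable_bound)
    show "integrable M (\<lambda>x. real (Suc k) powr enn2real p * \<bar>h x\<bar> powr enn2real p)"
      by (intro integrable_mult_right L_integrable h)
    show "AE x in M. norm (indicator (Z k) x :: real) \<le> norm (real (Suc k) powr enn2real p * \<bar>h x\<bar> powr enn2real p)"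
    proof (rule AE_I2)
      fix x
      show "norm (indicator (Z k) x :: real) \<le> norm (real (Suc k) powr enn2real p * \<bar>h x\<bar> powr enn2real p)"
      proof (cases "x \<in> Z k")
        case True
        then have "1 / real (Suc k) \<le> \<bar>h x\<bar>"
          unfolding Z_def by force
        then have "1 \<le> real (Suc k) * \<bar>h x\<bar>"
          by (simp add: divide_le_eq mult.commute)
        then have "1 \<le> (real (Suc k) * \<bar>h x\<bar>) powr enn2real p"
          using P_pos by (intro ge_one_powr_ge_zero) auto
        with True show ?thesis by (simp add: powr_mult)
      qed simp
    qed
  qed measurable
  then have "integrable M (\<lambda>x. norm (\<psi> x) powr enn2real q)"
    by (rule back_subst[of "integrable M"]) (auto simp: \<psi>_def indicator_def)
  then have \<psi>: "\<psi> \<in> Lp M q"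
    unfolding Lp_def using \<psi>_meas by (auto intro!: exI[of _ 1] simp: \<psi>_def indicator_def)
  moreover have "nonneg_fun M \<psi>"
    by (simp add: nonneg_fun_def \<psi>_def indicator_def)
  moreover have "\<not> ae_eq M \<psi> (\<lambda>x. 0)"
    using k by (simp add: ae_eq_def \<psi>_def indicator_def)
  moreover have "nonneg_fun M (cplx u)" "\<not> ae_eq M (cplx u) (\<lambda>x. 0)"
    using u(2,4) by (simp_all add: nonneg_fun_def ae_eq_def)
  ultimately obtain n where n: "0 < Re (pairing M ((A ^^ n) (cplx u)) \<psi>)"
    using irred cplx_Lp[OF u(1)] unfolding irreducible_op_def by blast
  have "AE x in M. (A ^^ n) (cplx u) x = cplx ((F ^^ n) u) x"
    by (rule representedD(3)[OF represented_power[OF rep] cplx_Lp[OF u(1)] u(1)]) simp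
  with posop_nonneg[OF Fn[of n] u(1,2)] F_le[of n] have "AE x in M. (A ^^ n) (cplx u) x * \<psi> x = 0"
  proof eventually_elim
    case (elim x)
    have "(F ^^ n) u x = 0" if "x \<in> Z k"
    proof -
      have "c ^ n * u x \<le> 0"
        using that c by (simp add: Z_def mult_nonneg_nonpos)
      with elim show ?thesis by linarith
    qed
    with elim show ?case
      by (cases "x \<in> Z k") (simp_all add: \<psi>_def)
  qed
  then have "pairing M ((A ^^ n) (cplx u)) \<psi> = 0"
    unfolding pairing_def by (rule integral_eq_zero_AE)
  with n show False by simp
qed

end


section \<open>Convergence of the approximate eigenfunctions\<close>

theorem theorem2p12:
  fixes M :: "'a measure" and p q :: ennreal
    and D :: "'a cfun set" and T R Ks Kf :: "'a operator"
    and keff :: real and N :: nat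
    and \<phi> :: "nat \<Rightarrow> 'a cfun" and \<gamma> :: "nat \<Rightarrow> real"
  assumes p: "1 \<le> p" "p < \<infinity>" and pq: "inverse p + inverse q = 1"
    and T: "lin_op M p D T" "densely_defined M p D" "spectral_bound M p D T < 0"
    and R: "is_resolvent M p D T 0 R"
    and R_pos: "\<And>f. f \<in> Lp_pos M p \<Longrightarrow> R f \<in> Lp_pos M p"
    and Ks: "bounded_op M p Ks" "nonneg_op M p Ks"
    and Kf: "bounded_op M p Kf" "nonneg_op M p Kf"
    and pow_compact: "power_compact M p (R \<circ> op_add Ks Kf)"
    and irred: "irreducible_op M p q (R \<circ> Kf)"
    and rad_0: "\<exists>L. ((\<lambda>t. spectral_radius M p (R \<circ> K_op Ks Kf t)) \<longlongrightarrow> L) (at_right 0) \<and> 1 < L"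
    and rad_Ks: "spectral_radius M p (R \<circ> Ks) < 1"
    and N: "\<And>t. 0 < t \<Longrightarrow> compact_op M p ((R \<circ> K_op Ks Kf t) ^^ N)"
    and keff: "is_keff M D T Ks Kf keff"
    and \<phi>: "\<And>k. \<phi> k \<in> D \<inter> Lp_pos M p"
    and \<gamma>: "\<And>k. 0 < \<gamma> k" "\<And>k. tau_plus M T Ks Kf (\<phi> k) = ennreal (\<gamma> k)" "\<gamma> \<longlonglongrightarrow> keff"
    and normalized: "\<And>k. Lp_norm M p (((R \<circ> K_op Ks Kf (\<gamma> k)) ^^ N) (\<phi> k)) = 1"
    and simple: "simple_eigenvalue M p (R \<circ> K_op Ks Kf keff) 1"
    and dual: "p = 1 \<Longrightarrow> \<exists>B' r g c. dual_op M p q (R \<circ> K_op Ks Kf keff) B' \<and>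
        0 \<le> r \<and> spectral_radius M q B' = ennreal r \<and>
        eigenfunction M q B' (complex_of_real r) g \<and>
        0 < c \<and> (AE x in M. c \<le> cmod (g x))"
  shows "\<exists>\<phi>eff \<in> D \<inter> Lp_pos M p.
      eigenfunction M p (R \<circ> K_op Ks Kf keff) 1 \<phi>eff \<and> Lp_norm M p \<phi>eff = 1 \<and>
      (\<forall>\<psi>\<in>Lp_pos M p. eigenfunction M p (R \<circ> K_op Ks Kf keff) 1 \<psi> \<and> Lp_norm M p \<psi> = 1 \<longrightarrow>
         ae_eq M \<psi> \<phi>eff) \<and>
      (\<lambda>k. Lp_norm M p (\<lambda>x. \<phi> k x - \<phi>eff x)) \<longlonglongrightarrow> 0"
proof -
  interpret Lp_exponent M p
    by standard (rule p)+
  have Rb: "bounded_op M p R"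
    using R by (simp add: is_resolvent_def)
  have Rnn: "nonneg_op M p R"
    by (rule nonneg_op_if_pos_preserving[OF Rb R_pos]) (use \<phi>[of 0] in auto)
  have D_Lp: "f \<in> Lp M p" if "f \<in> D" for f
    using T(1) that by (auto simp: lin_op_def)
  have T_Lp: "T f \<in> Lp M p" if "f \<in> D" for f
    using T(1) that by (auto simp: lin_op_def)
  have RT: "AE x in M. R (\<lambda>x. - T f x) x = f x" if "f \<in> D" for f
    using R that by (simp add: is_resolvent_def ae_eq_def)
  have K_in: "K_op Ks Kf t f \<in> Lp M p" if "f \<in> Lp M p" for t f
    unfolding K_op_def op_add_def op_scale_def
    by (intro Lp_add Lp_scale bounded_op_in[OF Ks(1)] bounded_op_in[OF Kf(1)] that)
  \<comment> \<open>Inverting \<open>T\<close> turns the sign of \<open>(T + K(t)) f\<close> into a comparison of \<open>R K(t) f\<close> with \<open>f\<close>.\<close>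
  have R_op_add: "AE x in M. (R \<circ> K_op Ks Kf t) f x = R (op_add T (K_op Ks Kf t) f) x + f x"
    if f: "f \<in> D" for t f
  proof -
    have 1: "op_add T (K_op Ks Kf t) f \<in> Lp M p"
      unfolding op_add_def by (intro Lp_add T_Lp K_in D_Lp f)
    have 2: "(\<lambda>x. - T f x) \<in> Lp M p"
      using Lp_scale[OF T_Lp[OF f], of "-1"] by simp
    have "K_op Ks Kf t f = (\<lambda>x. op_add T (K_op Ks Kf t) f x + - T f x)"
      by (simp add: op_add_def)
    then have "AE x in M. R (K_op Ks Kf t f) x = R (op_add T (K_op Ks Kf t) f) x + R (\<lambda>x. - T f x) x"
      using bounded_op_add[OF Rb 1 2] by metis
    with RT[OF f] show ?thesis by eventually_elim simp
  qed

  define R' Ks' Kf' where "R' = realify R" and "Ks' = realify Ks" and "Kf' = realify Kf"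
  have R': "posop R'" "represented R R'" and Ks': "posop Ks'" "represented Ks Ks'"
    and Kf': "posop Kf'" "represented Kf Kf'"
    unfolding R'_def Ks'_def Kf'_def
    by (auto intro: posop_realify realify_represented Rb Rnn Ks Kf)
  define S F where "S u = R' (Ks' u)" and "F u = R' (Kf' u)" for u
  have S: "posop S" and F: "posop F"
    unfolding S_def[abs_def] F_def[abs_def]
    by (rule posop_comp[OF R'(1) Ks'(1)] posop_comp[OF R'(1) Kf'(1)])+
  have F_rep: "represented (R \<circ> Kf) F"
    using represented_comp[OF R'(2) Kf'(2)] by (simp add: F_def[abs_def] comp_def)
  define A where "A t = (\<lambda>u x. S u x + t * F u x)" for t
  have A: "posop (A t)" if "0 \<le> t" for t
    unfolding A_def by (rule posop_add_scaled[OF S F that])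
  have A_rep: "represented (R \<circ> K_op Ks Kf t) (A (1 / t))" if "0 < t" for t
    unfolding represented_def
  proof (intro ballI impI conjI)
    fix f u assume f: "f \<in> Lp M p" and u: "u \<in> L" and fu: "AE x in M. f x = cplx u x"
    let ?K = "\<lambda>x. Ks' u x + 1 / t * Kf' u x"
    have Ku: "Ks' u \<in> L" "Kf' u \<in> L"
      using posop_in[OF Ks'(1) u] posop_in[OF Kf'(1) u] .
    have K: "?K \<in> L"
      by (intro Minkowski L_scale Ku)
    have "AE x in M. K_op Ks Kf t f x = cplx ?K x"
      using representedD(3)[OF Ks'(2) f u fu] representedD(3)[OF Kf'(2) f u fu]
      by eventually_elim (simp add: K_op_def op_add_def op_scale_def)
    note R_K = representedD[OF R'(2) K_in[OF f] K this]
    show "(R \<circ> K_op Ks Kf t) f \<in> Lp M p"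
      using R_K(1) by simp
    show "A (1 / t) u \<in> L"
      using that by (intro posop_in[OF A] u) simp
    show "AE x in M. (R \<circ> K_op Ks Kf t) f x = cplx (A (1 / t) u) x"
      using R_K(3) posop_add[OF R'(1) Ku(1) L_scale[OF Ku(2), of "1 / t"]] posop_scale[OF R'(1) Ku(2), of "1 / t"]
      by eventually_elim (simp add: A_def S_def F_def)
  qed

  have keff_pos: "0 < keff"
    using keff by (simp add: is_keff_def)
  obtain f where f: "f \<in> D" "nonneg_fun M f" "\<not> ae_eq M f (\<lambda>x. 0)"
    and Tf: "ae_eq M (op_add T (K_op Ks Kf keff) f) (\<lambda>x. 0)"
    using keff by (auto simp: is_keff_def)
  define e where "e x = Re (f x)" for x
  have e_L: "e \<in> L"
    unfolding e_def[abs_def] by (rule Re_L[OF D_Lp[OF f(1)]])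
  have fe: "AE x in M. f x = cplx e x"
    using f(2)[unfolded nonneg_fun_def] by eventually_elim (auto simp: e_def complex_is_Real_iff complex_eq_iff)
  define B where "B = A (1 / keff)"
  have B: "posop B" and B_rep: "represented (R \<circ> K_op Ks Kf keff) B"
    unfolding B_def using keff_pos by (auto intro: A A_rep)
  have "AE x in M. R (op_add T (K_op Ks Kf keff) f) x = 0"
  proof -
    have "AE x in M. R (op_add T (K_op Ks Kf keff) f) x = R (\<lambda>x. 0 * f x) x"
    proof (rule bounded_op_cong[OF Rb])
      show "op_add T (K_op Ks Kf keff) f \<in> Lp M p"
        unfolding op_add_def by (intro Lp_add T_Lp K_in D_Lp f)
    qed (use Tf Lp_scale[OF D_Lp[OF f(1)], of 0] in \<open>simp_all add: ae_eq_def\<close>)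
    with bounded_op_scale[OF Rb D_Lp[OF f(1)], of 0] show ?thesis
      by eventually_elim simp
  qed
  with R_op_add[OF f(1), of keff] have Bf: "AE x in M. (R \<circ> K_op Ks Kf keff) f x = f x"
    by eventually_elim simp
  have Be: "AE x in M. B e x = e x"
    using Bf fe representedD(3)[OF B_rep D_Lp[OF f(1)] e_L fe] by eventually_elim simp
  have e_nz: "\<not> (AE x in M. e x = 0)"
  proof
    assume "AE x in M. e x = 0"
    with fe have "AE x in M. f x = 0" by eventually_elim simp
    then show False using f(3) by (simp add: ae_eq_def)
  qed
  have e_nonneg: "AE x in M. 0 \<le> e x"
    using f(2) by (simp add: nonneg_fun_def e_def)

  define u where "u k x = Re (\<phi> k x)" for k x
  have \<phi>_Lp: "\<phi> k \<in> Lp M p" and \<phi>_pos: "AE x in M. \<phi> k x \<in> \<real> \<and> 0 < Re (\<phi> k x)" and \<phi>_D: "\<phi> k \<in> D" for k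
    using \<phi>[of k] by (auto simp: Lp_pos_def)
  have u: "u k \<in> L" for k
    unfolding u_def by (rule Re_L[OF \<phi>_Lp])
  have u_pos: "AE x in M. 0 < u k x" for k
    using \<phi>_pos[of k] by (simp add: u_def)
  have \<phi>u: "AE x in M. \<phi> k x = cplx (u k) x" for k
    using \<phi>_pos[of k] by eventually_elim (auto simp: u_def complex_is_Real_iff complex_eq_iff)

  have irreducible: "AE x in M. 0 < v x"
    if "v \<in> L" "AE x in M. 0 \<le> v x" "AE x in M. B v x \<le> v x" "\<not> (AE x in M. v x = 0)" for v
  proof (rule subinvariant_pos[OF irred F_rep F B _ _ u[of 0] u_pos[of 0] that])
    show "0 \<le> keff" using keff_pos by simp
    show "AE x in M. F v x \<le> keff * B v x" if "v \<in> L" "AE x in M. 0 \<le> v x" for v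
      using posop_nonneg[OF S that]
      by eventually_elim (use keff_pos in \<open>simp add: B_def A_def algebra_simps\<close>)
  qed
  have e_pos: "AE x in M. 0 < e x"
    by (rule irreducible[OF e_L e_nonneg _ e_nz]) (use Be in auto)
  interpret irreducible_fixed_point M "enn2real p" B e N
  proof
    show "\<exists>r g. strict_mono r \<and> g \<in> L \<and> (\<lambda>n. nrm (\<lambda>x. (B ^^ N) (v (r n)) x - g x)) \<longlonglongrightarrow> 0"
      if v: "\<And>n. v n \<in> L" "\<And>n. nrm (v n) \<le> C" for v :: "nat \<Rightarrow> 'a \<Rightarrow> real" and C
    proof -
      let ?A = "(R \<circ> K_op Ks Kf keff) ^^ N"
      have "(\<forall>n. cplx (v n) \<in> Lp M p) \<and> (\<exists>C. \<forall>n. Lp_norm M p (cplx (v n)) \<le> C)"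
        using v by (auto simp: cplx_Lp Lp_norm_cplx)
      from N[OF keff_pos, unfolded compact_op_def, THEN conjunct2, THEN spec, THEN mp, OF this]
      obtain r g where r: "strict_mono r" and g: "g \<in> Lp M p"
        and lim: "(\<lambda>n. Lp_norm M p (\<lambda>x. ?A (cplx (v (r n))) x - g x)) \<longlonglongrightarrow> 0"
        by blast
      have "nrm (\<lambda>x. (B ^^ N) (v n) x - Re (g x)) \<le> Lp_norm M p (\<lambda>x. ?A (cplx (v n)) x - g x)" for n
      proof -
        note rep = representedD[OF represented_power[OF B_rep, of N] cplx_Lp[OF v(1)[of n]] v(1)[of n] AE_I2[OF refl]]
        have "nrm (\<lambda>x. (B ^^ N) (v n) x - Re (g x)) = nrm (\<lambda>x. Re (?A (cplx (v n)) x - g x))"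
        proof (rule nrm_cong_AE[OF L_measurable[OF L_diff[OF rep(2) Re_L[OF g]]] L_measurable[OF Re_L[OF Lp_diff[OF rep(1) g]]]])
          show "AE x in M. (B ^^ N) (v n) x - Re (g x) = Re (?A (cplx (v n)) x - g x)"
            using rep(3) by eventually_elim simp
        qed
        also have "\<dots> \<le> Lp_norm M p (\<lambda>x. ?A (cplx (v n)) x - g x)"
          by (rule nrm_Re_le[OF Lp_diff[OF rep(1) g]])
        finally show ?thesis .
      qed
      then have "(\<lambda>n. nrm (\<lambda>x. (B ^^ N) (v (r n)) x - Re (g x))) \<longlonglongrightarrow> 0"
        by (rule nrm_squeeze[OF _ lim])
      with r Re_L[OF g] show ?thesis by blast
    qed
  qed (use B e_L e_pos Be e_nz irreducible in blast)+

  \<comment> \<open>\<open>R K(\<gamma>\<^sub>k)\<close> is the perturbation of \<open>R K(k\<^sub>e\<^sub>f\<^sub>f)\<close> by \<open>s\<^sub>k R K\<^sub>f\<close>.\<close>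
  define s where "s k = 1 / \<gamma> k - 1 / keff" for k
  have A_eq: "(\<lambda>v x. B v x + s k * F v x) = A (1 / \<gamma> k)" for k
    by (auto simp: B_def A_def s_def fun_eq_iff algebra_simps)
  have limit: "(\<lambda>k. nrm (\<lambda>x. u k x - 1 / nrm e * e x)) \<longlonglongrightarrow> 0"
  proof (rule perturbed_superinvariant_tendsto[where s=s and F=F])
    have "(\<lambda>k. 1 / \<gamma> k - 1 / keff) \<longlonglongrightarrow> 1 / keff - 1 / keff"
      using keff_pos by (intro tendsto_intros \<gamma>) auto
    then show "s \<longlonglongrightarrow> 0" by (simp add: s_def[abs_def])
    show "posop (\<lambda>v x. B v x + s k * F v x)" for k
      unfolding A_eq using \<gamma>(1)[of k] by (intro A) simp
    show "AE x in M. u k x \<le> B (u k) x + s k * F (u k) x" for k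
    proof -
      have "nonneg_fun M (R (op_add T (K_op Ks Kf (\<gamma> k)) (\<phi> k)))"
      proof (rule Rnn[unfolded nonneg_op_def, rule_format])
        show "op_add T (K_op Ks Kf (\<gamma> k)) (\<phi> k) \<in> Lp M p"
          unfolding op_add_def by (intro Lp_add T_Lp K_in D_Lp \<phi>_D)
        show "nonneg_fun M (op_add T (K_op Ks Kf (\<gamma> k)) (\<phi> k))"
          by (rule nonneg_at_tau_plus[OF \<gamma>(1,2)])
      qed
      then have "AE x in M. u k x \<le> A (1 / \<gamma> k) (u k) x"
        unfolding nonneg_fun_def
        using R_op_add[OF \<phi>_D[of k], of "\<gamma> k"] representedD(3)[OF A_rep[OF \<gamma>(1)[of k]] \<phi>_Lp[of k] u[of k] \<phi>u[of k]]
      proof eventually_elim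
        case (elim x)
        then have "complex_of_real (A (1 / \<gamma> k) (u k) x) = R (op_add T (K_op Ks Kf (\<gamma> k)) (\<phi> k)) x + \<phi> k x"
          by simp
        then have "A (1 / \<gamma> k) (u k) x = Re (R (op_add T (K_op Ks Kf (\<gamma> k)) (\<phi> k)) x) + Re (\<phi> k x)"
          by (metis Re_complex_of_real plus_complex.simps(1))
        with elim show ?case by (simp add: u_def)
      qed
      then show ?thesis by (simp add: A_eq[THEN fun_cong, THEN fun_cong, symmetric])
    qed
    show "nrm (((\<lambda>v x. B v x + s k * F v x) ^^ N) (u k)) = 1" for k
      using Lp_norm_cong_AE[OF representedD[OF represented_power[OF A_rep[OF \<gamma>(1)[of k]], of N]
          \<phi>_Lp[of k] u[of k] \<phi>u[of k]]] normalized[of k]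
      unfolding A_eq by simp
    show "AE x in M. 0 \<le> u k x" for k
      using u_pos[of k] by eventually_elim simp
  qed (rule F u)+

  have e_norm: "0 < nrm e"
    using nrm_eq_0[OF e_L] e_nz nrm_nonneg[of e] by (auto simp: less_le)
  define c where "c = complex_of_real (1 / nrm e)"
  define \<phi>eff where "\<phi>eff x = c * f x" for x
  have \<phi>eff_D: "\<phi>eff \<in> D"
    using T(1) f(1) unfolding lin_op_def \<phi>eff_def by blast
  have \<phi>eff_e: "AE x in M. \<phi>eff x = cplx (\<lambda>x. 1 / nrm e * e x) x"
    using fe by eventually_elim (simp add: \<phi>eff_def c_def)
  have normal_L: "(\<lambda>x. 1 / nrm e * e x) \<in> L"
    by (rule L_scale[OF e_L])
  have \<phi>eff_norm: "Lp_norm M p \<phi>eff = 1"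
    using Lp_norm_cong_AE[OF D_Lp[OF \<phi>eff_D] normal_L \<phi>eff_e] nrm_scale[of "1 / nrm e" e] e_norm by simp
  have \<phi>eff_pos: "\<phi>eff \<in> Lp_pos M p"
    unfolding Lp_pos_def mem_Collect_eq
  proof
    show "AE x in M. \<phi>eff x \<in> \<real> \<and> 0 < Re (\<phi>eff x)"
      using \<phi>eff_e e(2) by eventually_elim (use e_norm in simp)
  qed (rule D_Lp[OF \<phi>eff_D])
  have \<phi>eff_eigen: "eigenfunction M p (R \<circ> K_op Ks Kf keff) 1 \<phi>eff"
    unfolding eigenfunction_def ae_eq_def
  proof (intro conjI notI)
    assume "AE x in M. \<phi>eff x = 0"
    with \<phi>eff_e have "AE x in M. e x = 0"
      by eventually_elim (use e_norm in simp)
    then show False using e_nz by simp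
  next
    show "AE x in M. (R \<circ> K_op Ks Kf keff) \<phi>eff x = 1 * \<phi>eff x"
      using representedD(3)[OF B_rep D_Lp[OF \<phi>eff_D] normal_L \<phi>eff_e] \<phi>eff_e Be
        posop_scale[OF B e_L, of "1 / nrm e"]
      by eventually_elim simp
  qed (rule D_Lp[OF \<phi>eff_D])
  have unique: "ae_eq M \<psi> \<phi>eff"
    if \<psi>: "\<psi> \<in> Lp_pos M p" "eigenfunction M p (R \<circ> K_op Ks Kf keff) 1 \<psi>" "Lp_norm M p \<psi> = 1" for \<psi>
  proof -
    define g where "g x = Re (\<psi> x)" for x
    have \<psi>_Lp: "\<psi> \<in> Lp M p" and \<psi>_pos: "AE x in M. \<psi> x \<in> \<real> \<and> 0 < Re (\<psi> x)"
      using \<psi>(1) by (auto simp: Lp_pos_def)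
    have g: "g \<in> L"
      unfolding g_def[abs_def] by (rule Re_L[OF \<psi>_Lp])
    have \<psi>g: "AE x in M. \<psi> x = cplx g x"
      using \<psi>_pos by eventually_elim (auto simp: g_def complex_is_Real_iff complex_eq_iff)
    have g_pos: "AE x in M. 0 \<le> g x"
      using \<psi>_pos by eventually_elim (simp add: g_def)
    have "AE x in M. g x \<le> B g x"
      using representedD(3)[OF B_rep \<psi>_Lp g \<psi>g] \<psi>(2)[unfolded eigenfunction_def ae_eq_def, THEN conjunct2, THEN conjunct2] \<psi>g
      by eventually_elim simp
    from superinvariant_eq_normalized[OF g g_pos this]
    have "AE x in M. g x = 1 / nrm e * e x"
      using Lp_norm_cong_AE[OF \<psi>_Lp g \<psi>g] \<psi>(3) by simp
    with \<psi>g \<phi>eff_e show ?thesis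
      unfolding ae_eq_def by eventually_elim simp
  qed
  have "Lp_norm M p (\<lambda>x. \<phi> k x - \<phi>eff x) = nrm (\<lambda>x. u k x - 1 / nrm e * e x)" for k
  proof (rule Lp_norm_cong_AE[OF Lp_diff[OF \<phi>_Lp D_Lp[OF \<phi>eff_D]] L_diff[OF u normal_L]])
    show "AE x in M. \<phi> k x - \<phi>eff x = cplx (\<lambda>x. u k x - 1 / nrm e * e x) x"
      using \<phi>u[of k] \<phi>eff_e by eventually_elim simp
  qed
  with limit have "(\<lambda>k. Lp_norm M p (\<lambda>x. \<phi> k x - \<phi>eff x)) \<longlonglongrightarrow> 0"
    by simp
  with \<phi>eff_D \<phi>eff_pos \<phi>eff_eigen \<phi>eff_norm unique show ?thesis
    by blast
qed

end
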